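(* Let $n$ be a positive integer, and let $D$ and $D'$ be virtual-link diagrams which represent the same virtual-link. If $\#\mathrm{Col}_{n}(D)\neq \#\mathrm{Col}_{n}(D')$, then any finite sequence of generalized Reidemeister moves between $D$ and $D'$ includes at least one Reidemeister move of type II (RII-move).
   Context: A virtual-link diagram is a finite non-empty collection of oriented generic closed curves in $\mathbb R^2$ (immersed circles whose only multiple points are finitely many transverse double points), where each double point is either a real-crossing (equipped with over/under information) or a virtual-crossing (no over/under information). Diagrams are always oriented. Each closed curve is a component; a one-component diagram is a virtual-knot diagram. Generalized Reidemeister moves are the following local changes of diagrams inside a disk (in both directions, with all possible orientations of the strands), plane isotopies being allowed freely. RI: adding or removing a kink with one real-crossing (of any kind). RII: adding or removing a bigon formed by two strands with two real-crossings, one strand being over at both. RIII: moving one strand across the crossing of two others, where the three strands cross pairwise in three real-crossings, one strand being over both others, one under both others. VRI, VRII, VRIII: the analogues of the underlying planar moves with all crossings involved virtual. VRIV: moving a strand across a real-crossing of two other strands, where the moving strand meets each of the other two in a virtual-crossing. Two diagrams represent the same virtual-link if they are related by a finite sequence of generalized Reidemeister moves. A semi-arc of $D$ is an edge obtained by cutting the curves of $D$ at the real-crossings (both the over- and the under-strand are cut there; virtual-crossings are ignored): its end points are real-crossings and it has no real-crossing in its interior. A component with no real-crossing counts as a single semi-arc. $\mathcal{SA}(D)$ denotes the set of semi-arcs. Write $\mathbb Z_n=\mathbb Z/n\mathbb Z$. An $n$-up-down coloring of $D$ is a map $C:\mathcal{SA}(D)\to\mathbb Z_n$ such that at each real-crossing,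 if $u_1,u_2$ are the under-semi-arcs and $o_1,o_2$ the over-semi-arcs, with the orientation of $D$ pointing from $u_1$ to $u_2$ and from $o_1$ to $o_2$, then $C(u_2)=C(u_1)-1$ and $C(o_2)=C(o_1)+1$. $\mathrm{Col}_n(D)$ is the (finite) set of $n$-up-down colorings of $D$ and $\#\mathrm{Col}_n(D)$ its cardinality. *)

theory Defs
  imports "HOL-Analysis.Analysis" "HOL-Number_Theory.Cong"
begin

section \<open>Virtual-link diagrams\<close>

text \<open>
  Component \<open>i\<close> of a diagram is parametrised by the unit circle of the complex numbers,
  and is oriented by the counterclockwise direction of that circle.  A parameter point is a
  component together with a point of its circle.
\<close>

type_synonym param = "nat \<times> complex"

text \<open>
  \<open>over\<close> lists the real-crossings, each one as the pair (parameter of the over-strand,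
  parameter of the under-strand).  The double points not listed are the virtual-crossings.
\<close>

record diagram =
  comps :: nat
  curve :: "nat \<Rightarrow> complex \<Rightarrow> real ^ 2"
  over :: "(param \<times> param) set"

definition params :: "diagram \<Rightarrow> param set" where
  "params D = {..<comps D} \<times> sphere 0 1"

definition pt :: "diagram \<Rightarrow> param \<Rightarrow> real ^ 2" where
  "pt D p = curve D (fst p) (snd p)"

definition tangent :: "diagram \<Rightarrow> param \<Rightarrow> real ^ 2" where
  "tangent D p = vector_derivative (\<lambda>t. curve D (fst p) (snd p * cis t)) (at 0)"

definition double_points :: "diagram \<Rightarrow> param set set" where
  "double_points D =
    {{p, q} | p q. p \<in> params D \<and> q \<in> params D \<and> p \<noteq> q \<and> pt D p = pt D q}"

definition real_crossings :: "diagram \<Rightarrow> param set set" where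
  "real_crossings D = {{p, q} | p q. (p, q) \<in> over D}"

definition virtual_crossings :: "diagram \<Rightarrow> param set set" where
  "virtual_crossings D = double_points D - real_crossings D"

definition virtual_link_diagram :: "diagram \<Rightarrow> bool" where
  "virtual_link_diagram D \<longleftrightarrow>
     comps D > 0 \<and>
     (\<forall>i<comps D. (\<lambda>t. curve D i (cis t)) C1_differentiable_on UNIV) \<and>
     (\<forall>p\<in>params D. tangent D p \<noteq> 0) \<and>
     finite (double_points D) \<and>
     (\<forall>p\<in>params D. \<forall>q\<in>params D. \<forall>r\<in>params D.
        pt D p = pt D q \<and> pt D q = pt D r \<longrightarrow> p = q \<or> q = r \<or> p = r) \<and>
     (\<forall>p\<in>params D. \<forall>q\<in>params D.
        p \<noteq> q \<and> pt D p = pt D q \<longrightarrow> tangent D p \<notin> span {tangent D q}) \<and>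
     (\<forall>(p, q)\<in>over D. {p, q} \<in> double_points D \<and> (q, p) \<notin> over D)"


section \<open>Semi-arcs and up-down colorings\<close>

definition cuts :: "diagram \<Rightarrow> nat \<Rightarrow> complex set" where
  "cuts D i = {z. (i, z) \<in> \<Union> (real_crossings D)}"

text \<open>
  A semi-arc is represented by its component and its interior in the parameter circle (the
  whole circle if the component has no real-crossing).
\<close>

definition semi_arcs :: "diagram \<Rightarrow> (nat \<times> complex set) set" where
  "semi_arcs D = (SIGMA i:{..<comps D}. components (sphere 0 1 - cuts D i))"

definition arc_into :: "nat \<times> complex set \<Rightarrow> param \<Rightarrow> bool" where
  "arc_into a p \<longleftrightarrow> fst a = fst p \<and> (\<forall>\<^sub>F t in at_left 0. snd p * cis t \<in> snd a)"

definition arc_out_of :: "nat \<times> complex set \<Rightarrow> param \<Rightarrow> bool" where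
  "arc_out_of a p \<longleftrightarrow> fst a = fst p \<and> (\<forall>\<^sub>F t in at_right 0. snd p * cis t \<in> snd a)"

text \<open>
  Colors are the representatives \<open>0, \<dots>, n - 1\<close> of the residue classes modulo \<open>n\<close>.
  At a real-crossing each of the semi-arcs \<open>o1, o2, u1, u2\<close> exists and is unique, because
  there are only finitely many cut points.
\<close>

definition up_down_colorings :: "nat \<Rightarrow> diagram \<Rightarrow> (nat \<times> complex set \<Rightarrow> int) set" where
  "up_down_colorings n D =
    {C \<in> semi_arcs D \<rightarrow>\<^sub>E {0..<int n}.
       \<forall>(p, q)\<in>over D.
         \<forall>o1\<in>semi_arcs D. \<forall>o2\<in>semi_arcs D. \<forall>u1\<in>semi_arcs D. \<forall>u2\<in>semi_arcs D.
           arc_into o1 p \<and> arc_out_of o2 p \<and> arc_into u1 q \<and> arc_out_of u2 q \<longrightarrow>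
             [C u2 = C u1 - 1] (mod int n) \<and> [C o2 = C o1 + 1] (mod int n)}"


section \<open>Plane isotopy\<close>

definition circle_reparam :: "(complex \<Rightarrow> complex) \<Rightarrow> bool" where
  "circle_reparam \<phi> \<longleftrightarrow>
     (\<exists>f :: real \<Rightarrow> real. continuous_on UNIV f \<and> strict_mono f \<and>
        (\<forall>t. f (t + 2 * pi) = f t + 2 * pi) \<and> (\<forall>t. \<phi> (cis t) = cis (f t)))"

text \<open>
  The curves of a diagram are an unnumbered collection of oriented curves, so renumbering
  \<open>\<pi>\<close> and orientation-preserving reparametrisation \<open>\<phi>\<close> are allowed along with the ambient
  isotopy from the identity to \<open>h\<close>.
\<close>

definition plane_isotopic :: "diagram \<Rightarrow> diagram \<Rightarrow> bool" where
  "plane_isotopic D D' \<longleftrightarrow>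
     (\<exists>h \<pi> \<phi>.
        homotopic_with_canon (\<lambda>k. \<exists>k'. homeomorphism UNIV UNIV k k') UNIV UNIV id h \<and>
        bij_betw \<pi> {..<comps D} {..<comps D'} \<and>
        (\<forall>i<comps D. circle_reparam (\<phi> i) \<and>
           (\<forall>z\<in>sphere 0 1. curve D' (\<pi> i) (\<phi> i z) = h (curve D i z))) \<and>
        over D' = map_prod (\<lambda>(i, z). (\<pi> i, \<phi> i z)) (\<lambda>(i, z). (\<pi> i, \<phi> i z)) ` over D)"


section \<open>Generalized Reidemeister moves\<close>

text \<open>
  The strand \<open>(i, a, b)\<close> is the part of component \<open>i\<close> over the angles from \<open>a\<close> to \<open>b\<close>.
\<close>

type_synonym strand = "nat \<times> real \<times> real"

fun angles :: "strand \<Rightarrow> real set" where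
  "angles (i, a, b) = {a<..<b}"

fun pos :: "strand \<Rightarrow> real \<Rightarrow> param" where
  "pos (i, a, b) t = (i, cis t)"

fun strand_params :: "strand \<Rightarrow> param set" where
  "strand_params (i, a, b) = pos (i, a, b) ` {a..b}"

definition strands_in_disk :: "diagram \<Rightarrow> (real ^ 2) set \<Rightarrow> strand list \<Rightarrow> bool" where
  "strands_in_disk D B ss \<longleftrightarrow>
     (\<forall>(i, a, b)\<in>set ss. i < comps D \<and> a < b \<and> b < a + 2 * pi \<and>
        curve D i (cis a) \<in> frontier B \<and> curve D i (cis b) \<in> frontier B \<and>
        (\<forall>t\<in>{a<..<b}. curve D i (cis t) \<in> interior B)) \<and>
     disjoint_family_on (\<lambda>j. strand_params (ss ! j)) {..<length ss} \<and>
     {p \<in> params D. pt D p \<in> B} = \<Union> (strand_params ` set ss)"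

text \<open>
  \<open>D\<close> and \<open>D'\<close> agree outside the closed disk \<open>B\<close>, and both run through \<open>B\<close> in the strands
  \<open>ss\<close>, with common end points and directions.
\<close>

definition local_change ::
    "(real ^ 2) set \<Rightarrow> strand list \<Rightarrow> diagram \<Rightarrow> diagram \<Rightarrow> bool" where
  "local_change B ss D D' \<longleftrightarrow>
     B homeomorphic (cball 0 1 :: (real ^ 2) set) \<and>
     comps D = comps D' \<and>
     strands_in_disk D B ss \<and> strands_in_disk D' B ss \<and>
     (\<forall>p\<in>params D. pt D p \<notin> interior B \<longrightarrow> pt D' p = pt D p) \<and>
     {(p, q) \<in> over D. pt D p \<notin> B} = {(p, q) \<in> over D'. pt D' p \<notin> B}"

definition crossings_in :: "diagram \<Rightarrow> (real ^ 2) set \<Rightarrow> param set set" where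
  "crossings_in D B = {c \<in> double_points D. pt D ` c \<subseteq> B}"

text \<open>\<open>D'\<close> arises from \<open>D\<close> by adding a kink whose crossing is \<open>c\<close>.\<close>

definition adds_kink :: "diagram \<Rightarrow> diagram \<Rightarrow> param set \<Rightarrow> bool" where
  "adds_kink D D' c \<longleftrightarrow>
     (\<exists>B s t u. local_change B [s] D D' \<and> {t, u} \<subseteq> angles s \<and> c = {pos s t, pos s u} \<and>
        crossings_in D B = {} \<and> crossings_in D' B = {c})"

text \<open>
  \<open>D'\<close> arises from \<open>D\<close> by adding a bigon between two strands; its corners are the crossings
  of the parameters \<open>p1, q1\<close> and of \<open>p2, q2\<close>, where \<open>p1, p2\<close> lie on one strand and
  \<open>q1, q2\<close> on the other.
\<close>

definition adds_bigon ::
    "diagram \<Rightarrow> diagram \<Rightarrow> param \<times> param \<Rightarrow> param \<times> param \<Rightarrow> bool" where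
  "adds_bigon D D' = (\<lambda>(p1, q1) (p2, q2).
     (\<exists>B r s t1 t2 u1 u2. local_change B [r, s] D D' \<and>
        {t1, t2} \<subseteq> angles r \<and> {u1, u2} \<subseteq> angles s \<and> t1 \<noteq> t2 \<and> u1 \<noteq> u2 \<and>
        p1 = pos r t1 \<and> q1 = pos s u1 \<and> p2 = pos r t2 \<and> q2 = pos s u2 \<and>
        crossings_in D B = {} \<and> crossings_in D' B = {{p1, q1}, {p2, q2}}))"

text \<open>
  Three strands which cross pairwise once; \<open>\<tau> j k\<close> is the angle at which strand \<open>j\<close> meets
  strand \<open>k\<close>, so that \<open>P j k\<close> and \<open>P k j\<close> below are the two parameters of their crossing.
\<close>

definition triangle ::
    "diagram \<Rightarrow> (real ^ 2) set \<Rightarrow> strand list \<Rightarrow> (nat \<Rightarrow> nat \<Rightarrow> real) \<Rightarrow> bool" where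
  "triangle D B ss \<tau> \<longleftrightarrow>
     (\<forall>j<3. \<forall>k<3. j \<noteq> k \<longrightarrow> \<tau> j k \<in> angles (ss ! j)) \<and>
     crossings_in D B = {{pos (ss ! j) (\<tau> j k), pos (ss ! k) (\<tau> k j)} | j k. j < k \<and> k < 3}"

text \<open>
  Moving one of three pairwise crossing strands across the crossing of the other two: the end
  points are kept, and on every strand the order of the two crossings is reversed.
\<close>

definition slides_triangle ::
    "diagram \<Rightarrow> diagram \<Rightarrow> (nat \<Rightarrow> nat \<Rightarrow> param) \<Rightarrow> (nat \<Rightarrow> nat \<Rightarrow> param) \<Rightarrow> bool" where
  "slides_triangle D D' P P' \<longleftrightarrow>
     (\<exists>B ss \<tau> \<tau>'. length ss = 3 \<and> local_change B ss D D' \<and>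
        triangle D B ss \<tau> \<and> triangle D' B ss \<tau>' \<and>
        P = (\<lambda>j k. pos (ss ! j) (\<tau> j k)) \<and> P' = (\<lambda>j k. pos (ss ! j) (\<tau>' j k)) \<and>
        (\<forall>j<3. \<forall>k<3. \<forall>l<3. distinct [j, k, l] \<longrightarrow> (\<tau> j k < \<tau> j l \<longleftrightarrow> \<tau>' j l < \<tau>' j k)))"

datatype move = RI | RII | RIII | VRI | VRII | VRIII | VRIV

text \<open>
  The numbering of the strands is arbitrary, hence the roles can be assigned to them in a fixed
  order.  In RIII the strands 0, 1, 2 are the top, middle and bottom one; in VRIV strand 0
  meets the other two in virtual-crossings and strand 1 is over strand 2.
\<close>

fun directed_move :: "move \<Rightarrow> diagram \<Rightarrow> diagram \<Rightarrow> bool" where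
  "directed_move RI D D' \<longleftrightarrow> (\<exists>c. adds_kink D D' c \<and> c \<in> real_crossings D')"
| "directed_move RII D D' \<longleftrightarrow> (\<exists>x y. adds_bigon D D' x y \<and> x \<in> over D' \<and> y \<in> over D')"
| "directed_move RIII D D' \<longleftrightarrow>
     (\<exists>P P'. slides_triangle D D' P P' \<and>
        (\<forall>j k. j < k \<and> k < 3 \<longrightarrow> (P j k, P k j) \<in> over D \<and> (P' j k, P' k j) \<in> over D'))"
| "directed_move VRI D D' \<longleftrightarrow> (\<exists>c. adds_kink D D' c \<and> c \<in> virtual_crossings D')"
| "directed_move VRII D D' \<longleftrightarrow>
     (\<exists>p1 q1 p2 q2. adds_bigon D D' (p1, q1) (p2, q2) \<and>
        {p1, q1} \<in> virtual_crossings D' \<and> {p2, q2} \<in> virtual_crossings D')"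
| "directed_move VRIII D D' \<longleftrightarrow>
     (\<exists>P P'. slides_triangle D D' P P' \<and>
        (\<forall>j k. j < k \<and> k < 3 \<longrightarrow>
           {P j k, P k j} \<in> virtual_crossings D \<and> {P' j k, P' k j} \<in> virtual_crossings D'))"
| "directed_move VRIV D D' \<longleftrightarrow>
     (\<exists>P P'. slides_triangle D D' P P' \<and>
        (\<forall>k\<in>{1, 2}.
           {P 0 k, P k 0} \<in> virtual_crossings D \<and> {P' 0 k, P' k 0} \<in> virtual_crossings D') \<and>
        (P 1 2, P 2 1) \<in> over D \<and> (P' 1 2, P' 2 1) \<in> over D')"

definition generalized_reidemeister :: "move \<Rightarrow> diagram \<Rightarrow> diagram \<Rightarrow> bool" where
  "generalized_reidemeister M D D' \<longleftrightarrow> directed_move M D D' \<or> directed_move M D' D"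

text \<open>
  \<open>move_sequence D Ms D'\<close>: the moves \<open>Ms\<close>, performed in this order and with plane isotopies
  inserted freely, lead from \<open>D\<close> to \<open>D'\<close>.
\<close>

inductive move_sequence :: "diagram \<Rightarrow> move list \<Rightarrow> diagram \<Rightarrow> bool" where
  refl: "virtual_link_diagram D \<Longrightarrow> move_sequence D [] D"
| isotopy: "\<lbrakk>virtual_link_diagram D; plane_isotopic D E; move_sequence E Ms D'\<rbrakk>
    \<Longrightarrow> move_sequence D Ms D'"
| move: "\<lbrakk>virtual_link_diagram D; generalized_reidemeister M D E; move_sequence E Ms D'\<rbrakk>
    \<Longrightarrow> move_sequence D (M # Ms) D'"

definition same_virtual_link :: "diagram \<Rightarrow> diagram \<Rightarrow> bool" where
  "same_virtual_link D D' \<longleftrightarrow> (\<exists>Ms. move_sequence D Ms D')"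

end

theory Submission
  imports Defs
begin

text \<open>
  Running once along component \<open>i\<close>, the color goes up by one at each over-passage and down by
  one at each under-passage.  Hence a coloring of the component is determined by the color after
  a base point, which is arbitrary, and it exists iff \<open>n\<close> divides the number of over-passages
  minus the number of under-passages of the component (\<open>crossing_index\<close>).  So the number of
  colorings is \<open>n ^ comps D\<close> if \<open>n\<close> divides all indices, and \<open>0\<close> otherwise.
  Every move other than RII preserves each index: RI adds one over- and one under-passage on the
  same component, RIII and VRIV keep the real-crossings between any two strands, and the
  remaining moves do not involve real-crossings at all.
\<close>

section \<open>Step functions on the circle\<close>

text \<open>Semi-arcs are components of a circle minus a finite set and carry no order, so running
  along a component has no direct meaning. It is replaced by one-sided germs: the points
  \<open>z * cis t\<close> for small \<open>t\<close> of one sign. A color then becomes a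
  right-continuous function of the parameter, and a crossing condition becomes the difference
  between its value and its left limit. Summing indicators of \<open>Arg2pi\<close> yields an
  explicit function with the prescribed jumps. The price is one extra discontinuity at the point 1,
  where \<open>Arg2pi\<close> is cut; its size is the crossing index, so it is invisible modulo
  \<open>n\<close> exactly under the divisibility condition. RII is the exception because it puts
  two over-passages on one strand and two under-passages on the other: if these belong to different
  components, one index rises by 2 and the other falls by 2.\<close>

lemma Arg2pi_cis: "0 \<le> x \<Longrightarrow> x < 2 * pi \<Longrightarrow> Arg2pi (cis x) = x"
  by (rule Arg2pi_unique[of 1]) (auto simp: cis_conv_exp)

lemma cis_Arg2pi: "norm z = 1 \<Longrightarrow> cis (Arg2pi z) = z"
  using Arg2pi_eq[of z] by (simp add: cis_conv_exp)

lemma Arg2pi_bounds: "0 \<le> Arg2pi z" "Arg2pi z < 2 * pi"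
  using Arg2pi[of z] by auto

lemma Arg2pi_inject: "norm z = 1 \<Longrightarrow> norm w = 1 \<Longrightarrow> Arg2pi z = Arg2pi w \<longleftrightarrow> z = w"
  by (metis cis_Arg2pi)

lemma Arg2pi_mult_cis:
  assumes "norm z = 1" "0 \<le> Arg2pi z + t" "Arg2pi z + t < 2 * pi"
  shows "Arg2pi (z * cis t) = Arg2pi z + t"
  using Arg2pi_cis[OF assms(2,3)] cis_Arg2pi[OF assms(1)] by (simp add: cis_mult[symmetric])

text \<open>The branch of \<open>Arg2pi\<close> is closed at 0, so moving forward is harmless at
  every point, including \<open>z = 1\<close>.\<close>

lemma angle_step_right:
  assumes "norm z = 1"
  shows "\<forall>\<^sub>F t in at_right 0. Arg2pi a \<le> Arg2pi (z * cis t) \<longleftrightarrow> Arg2pi a \<le> Arg2pi z"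
proof (rule eventually_at_rightI)
  \<comment> \<open>Below this bound the angle neither wraps around at \<open>2 * pi\<close> nor
    reaches \<open>a\<close> from below; the 1 stands for no further restriction of
    importance.\<close>
  let ?b = "min (2 * pi - Arg2pi z) (if Arg2pi z < Arg2pi a then Arg2pi a - Arg2pi z else 1)"
  show "0 < ?b" using Arg2pi_bounds[of z] by simp
  fix t assume t: "t \<in> {0<..<?b}"
  then have "Arg2pi (z * cis t) = Arg2pi z + t"
    using Arg2pi_bounds[of z] by (intro Arg2pi_mult_cis assms) auto
  then show "Arg2pi a \<le> Arg2pi (z * cis t) \<longleftrightarrow> Arg2pi a \<le> Arg2pi z"
    using t by (auto split: if_splits)
qed

text \<open>Moving backward loses the step located at \<open>a = z\<close>. From
  \<open>z = 1\<close> the angle also wraps to values just below \<open>2 * pi\<close>, which lie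
  beyond every \<open>a\<close>; the last summand accounts for this.\<close>

lemma angle_step_left:
  assumes "norm a = 1" "norm z = 1"
  shows "\<forall>\<^sub>F t in at_left 0. of_bool (Arg2pi a \<le> Arg2pi (z * cis t)) =
           of_bool (Arg2pi a \<le> Arg2pi z) - of_bool (a = z) + (of_bool (z = 1) :: int)"
proof (cases "z = 1")
  case True
  show ?thesis
  proof (rule eventually_at_leftI)
    \<comment> \<open>The bound is chosen so that the wrapped angle \<open>t + 2 * pi\<close> is
      still beyond \<open>a\<close>.\<close>
    show "Arg2pi a - 2 * pi < 0" using Arg2pi_bounds[of a] by simp
    fix t assume t: "t \<in> {Arg2pi a - 2 * pi<..<0}"
    then have "Arg2pi (cis (t + 2 * pi)) = t + 2 * pi"
      using Arg2pi_bounds[of a] by (intro Arg2pi_cis) auto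
    then have "Arg2pi (z * cis t) = t + 2 * pi"
      by (simp add: True cis_mult[symmetric])
    moreover have "Arg2pi a \<le> Arg2pi z \<longleftrightarrow> a = z"
      using Arg2pi_inject[OF assms] Arg2pi_bounds[of a] Arg2pi_cis[of 0] by (auto simp: True)
    ultimately show "of_bool (Arg2pi a \<le> Arg2pi (z * cis t)) =
           of_bool (Arg2pi a \<le> Arg2pi z) - of_bool (a = z) + (of_bool (z = 1) :: int)"
      using t by (simp add: True)
  qed
next
  case False
  have pos: "0 < Arg2pi z"
    using Arg2pi_inject[of z 1] assms False Arg2pi_bounds[of z] Arg2pi_cis[of 0] by force
  \<comment> \<open>If \<open>a\<close> comes before \<open>z\<close>, the motion has to stop short
    of \<open>a\<close>; otherwise it only has to stop short of the angle 0.\<close>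
  let ?b = "if Arg2pi a < Arg2pi z then Arg2pi a - Arg2pi z else - Arg2pi z"
  show ?thesis
  proof (rule eventually_at_leftI)
    show "?b < 0" using pos by simp
    fix t assume t: "t \<in> {?b<..<0}"
    then have "Arg2pi (z * cis t) = Arg2pi z + t"
      using Arg2pi_bounds[of z] Arg2pi_bounds[of a]
      by (intro Arg2pi_mult_cis assms) (auto split: if_splits)
    moreover have "a = z \<longleftrightarrow> Arg2pi a = Arg2pi z"
      using Arg2pi_inject[OF assms] by simp
    ultimately show "of_bool (Arg2pi a \<le> Arg2pi (z * cis t)) =
           of_bool (Arg2pi a \<le> Arg2pi z) - of_bool (a = z) + (of_bool (z = 1) :: int)"
      using t False by (auto split: if_splits)
  qed
qed

section \<open>Local constancy on the circle, tested in the angular coordinate\<close>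

lemma eventually_at_shift:
  "(\<forall>\<^sub>F t in at_right (x::real). P t) \<longleftrightarrow> (\<forall>\<^sub>F t in at_right 0. P (x + t))"
  "(\<forall>\<^sub>F t in at_left (x::real). P t) \<longleftrightarrow> (\<forall>\<^sub>F t in at_left 0. P (x + t))"
  unfolding at_right_to_0[of x] at_left_to_0[of x] eventually_filtermap by (simp_all add: add.commute)

text \<open>Cutting the circle at 1 leaves an interval, on which a locally constant function is
  constant; right-continuity at 1 ties this constant to \<open>F 1\<close>. No left condition is
  imposed at 1, so that the result can be applied before the jump there is known to vanish.\<close>

lemma constant_on_circle:
  fixes F :: "complex \<Rightarrow> 'a"
  assumes right: "\<And>z. norm z = 1 \<Longrightarrow> \<forall>\<^sub>F t in at_right 0. F (z * cis t) = F z"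
    and left: "\<And>z. norm z = 1 \<Longrightarrow> z \<noteq> 1 \<Longrightarrow> \<forall>\<^sub>F t in at_left 0. F (z * cis t) = F z"
    and z: "norm z = 1"
  shows "F z = F 1"
proof -
  let ?f = "\<lambda>t. F (cis t)" and ?I = "{0<..<2 * pi}"
  have "?f constant_on ?I"
  proof (rule locally_constant_imp_constant)
    fix x assume x: "x \<in> ?I"
    then have "cis x \<noteq> 1"
      using Arg2pi_cis[of x] Arg2pi_cis[of 0] by auto
    then have "\<forall>\<^sub>F t in at_left 0. ?f (x + t) = ?f x" "\<forall>\<^sub>F t in at_right 0. ?f (x + t) = ?f x"
      using left[of "cis x"] right[of "cis x"] by (simp_all add: cis_mult)
    then have "\<forall>\<^sub>F t in at x. ?f t = ?f x"
      unfolding eventually_at_split eventually_at_shift[of _ x] by blast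
    then have "\<forall>\<^sub>F t in nhds x. ?f t = ?f x"
      by (simp add: eventually_nhds_conv_at)
    then obtain U where U: "open U" "x \<in> U" "\<forall>t\<in>U. ?f t = ?f x"
      unfolding eventually_nhds by blast
    have "openin (top_of_set ?I) (?I \<inter> U)"
      using U(1) by (rule openin_open_Int)
    with x U(2,3) show "\<exists>T. openin (top_of_set ?I) T \<and> x \<in> T \<and> (\<forall>t\<in>T. ?f t = ?f x)"
      by blast
  qed simp
  then obtain c where c: "\<And>t. t \<in> ?I \<Longrightarrow> ?f t = c"
    unfolding constant_on_def by blast
  have "\<forall>\<^sub>F t in at_right 0. t \<in> ?I"
    by (rule eventually_at_rightI[of _ "2 * pi"]) auto
  moreover have "\<forall>\<^sub>F t in at_right 0. F (cis t) = F 1"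
    using right[of 1] by simp
  ultimately have "\<forall>\<^sub>F t in at_right 0. t \<in> ?I \<and> F (cis t) = F 1"
    by (rule eventually_conj)
  then obtain t where "t \<in> ?I" "F (cis t) = F 1"
    using eventually_happens' trivial_limit_at_right_real by blast
  then have "c = F 1"
    using c by simp
  moreover have "Arg2pi z = 0 \<or> Arg2pi z \<in> ?I"
    using Arg2pi_bounds[of z] by auto
  ultimately show ?thesis
    using c cis_Arg2pi[OF z] by (metis cis_zero)
qed

text \<open>\<open>Arg (w / z)\<close> is the inverse of the chart sending \<open>t\<close> to
  \<open>z * cis t\<close>, and it is continuous at \<open>w = z\<close> because \<open>Arg\<close>
  is continuous at 1. Thus a condition on small angles becomes a condition on a neighborhood in the
  circle.\<close>

lemma eventually_near_on_circle:
  assumes "\<forall>\<^sub>F t in at 0. P (z * cis t)" "norm z = 1"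
  shows "\<forall>\<^sub>F w in at z within sphere 0 1. P w"
proof -
  have "isCont Arg (z / z)"
    using assms(2) by (intro continuous_at_Arg) auto
  then have "((\<lambda>w. Arg (w / z)) \<longlongrightarrow> Arg (z / z)) (at z within sphere 0 1)"
    using assms(2)
    by (intro isCont_tendsto_compose[of _ Arg] tendsto_divide tendsto_ident_at tendsto_const) auto
  moreover have "z / z = 1" using assms(2) by auto
  ultimately have lim: "((\<lambda>w. Arg (w / z)) \<longlongrightarrow> 0) (at z within sphere 0 1)"
    by simp
  have repr: "z * cis (Arg (w / z)) = w" if "w \<in> sphere 0 1" for w
  proof -
    have "cis (Arg (w / z)) = w / z"
      using that assms(2) by (subst cis_Arg) (auto simp: sgn_eq norm_divide)
    then show ?thesis using assms(2) by auto
  qed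
  have sph: "\<forall>\<^sub>F w in at z within sphere 0 1. w \<in> sphere 0 1 \<and> w \<noteq> z"
    by (simp add: eventually_at_filter)
  then have "\<forall>\<^sub>F w in at z within sphere 0 1. Arg (w / z) \<noteq> 0"
  proof eventually_elim
    case (elim w)
    then show ?case using repr[of w] by auto
  qed
  with lim have "filterlim (\<lambda>w. Arg (w / z)) (at 0) (at z within sphere 0 1)"
    by (simp add: filterlim_at)
  then have "\<forall>\<^sub>F w in at z within sphere 0 1. P (z * cis (Arg (w / z)))"
    using assms(1) by (rule eventually_compose_filterlim[rotated])
  with sph show ?thesis
    by eventually_elim (use repr in auto)
qed

lemma constant_on_connected_circle_subset:
  fixes F :: "complex \<Rightarrow> 'a"
  assumes A: "connected A" "A \<subseteq> sphere 0 1"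
    and loc: "\<And>z. z \<in> A \<Longrightarrow> \<forall>\<^sub>F t in at 0. F (z * cis t) = F z"
  shows "F constant_on A"
proof (rule locally_constant_imp_constant[OF A(1)])
  fix z assume z: "z \<in> A"
  then have "\<forall>\<^sub>F w in at z within sphere 0 1. F w = F z"
    using A(2) by (intro eventually_near_on_circle[OF loc]) auto
  then obtain U where "open U" "z \<in> U" "\<forall>w\<in>U. w \<noteq> z \<longrightarrow> w \<in> sphere 0 1 \<longrightarrow> F w = F z"
    unfolding eventually_at_topological by blast
  then show "\<exists>T. openin (top_of_set A) T \<and> z \<in> T \<and> (\<forall>x\<in>T. F x = F z)"
    using z A(2) by (intro exI[of _ "A \<inter> U"]) (auto simp: subset_iff)
qed

section \<open>Components of the circle minus a finite set\<close>

lemma eventually_avoids_finite: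
  assumes "finite K" "norm z = 1"
  shows "\<exists>e>0. \<forall>t. t \<noteq> 0 \<and> \<bar>t\<bar> < e \<longrightarrow> z * cis t \<in> sphere 0 1 - K"
proof -
  have "\<forall>\<^sub>F t in nhds 0. z * cis t \<in> - (K - {z})"
  proof (rule topological_tendstoD)
    show "((\<lambda>t. z * cis t) \<longlongrightarrow> z) (nhds 0)"
      using tendsto_mult[OF tendsto_const tendsto_cis[OF filterlim_ident], of z "0::real"] by simp
    show "open (- (K - {z}))"
      using assms(1) by (intro open_Compl finite_imp_closed) simp
  qed simp
  then obtain e where e: "e > 0" "\<And>t. \<bar>t\<bar> < e \<Longrightarrow> z * cis t \<in> - (K - {z})"
    unfolding eventually_nhds_metric by (auto simp: dist_real_def)
  \<comment> \<open>The point \<open>z\<close> may itself belong to \<open>K\<close>, so it must not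
    be met again; below \<open>pi\<close> the function \<open>Arg\<close> recovers \<open>t\<close>
    from \<open>cis t\<close>.\<close>
  have "z * cis t \<noteq> z" if "t \<noteq> 0" "\<bar>t\<bar> < pi" for t
  proof
    assume "z * cis t = z"
    then have "cis t = 1" using assms(2) by auto
    moreover have "Arg (cis t) = t" using that by (intro Arg_cis) auto
    ultimately show False using that by simp
  qed
  with e assms(2) show ?thesis
    by (intro exI[of _ "min e pi"]) (force simp: norm_mult)
qed

text \<open>A short open arc on one side of \<open>z\<close> is connected and avoids
  \<open>K\<close>, hence lies in a single component, even when \<open>z\<close> is one of the
  removed points.\<close>

lemma component_adjacent:
  assumes "finite K" "norm z = 1"
  shows "\<exists>A\<in>components (sphere 0 1 - K). \<forall>\<^sub>F t in at_right 0. z * cis t \<in> A"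
    and "\<exists>A\<in>components (sphere 0 1 - K). \<forall>\<^sub>F t in at_left 0. z * cis t \<in> A"
proof -
  obtain e where e: "e > 0" "\<And>t. t \<noteq> 0 \<Longrightarrow> \<bar>t\<bar> < e \<Longrightarrow> z * cis t \<in> sphere 0 1 - K"
    using eventually_avoids_finite[OF assms] by blast
  have conn: "connected ((\<lambda>t. z * cis t) ` {a<..<b})" for a b :: real
    by (intro connected_continuous_image continuous_intros) simp
  have "\<exists>A\<in>components (sphere 0 1 - K). (\<lambda>t. z * cis t) ` {a<..<b} \<subseteq> A"
    if "-e \<le> a" "a < b" "b \<le> e" "0 \<notin> {a<..<b}" for a b
  proof -
    have sub: "(\<lambda>t. z * cis t) ` {a<..<b} \<subseteq> sphere 0 1 - K"
    proof (rule image_subsetI)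
      fix t assume "t \<in> {a<..<b}"
      with that have "t \<noteq> 0" "\<bar>t\<bar> < e" by (auto simp: abs_less_iff)
      then show "z * cis t \<in> sphere 0 1 - K" by (rule e(2))
    qed
    moreover have "sphere 0 1 - K \<noteq> {}"
      using e(2)[of "e / 2"] e(1) by auto
    ultimately show ?thesis
      using exists_component_superset[OF sub _ conn] by auto
  qed
  from this[of 0 e] this[of "-e" 0] e(1) obtain A B
    where A: "A \<in> components (sphere 0 1 - K)" "(\<lambda>t. z * cis t) ` {0<..<e} \<subseteq> A"
      and B: "B \<in> components (sphere 0 1 - K)" "(\<lambda>t. z * cis t) ` {-e<..<0} \<subseteq> B"
    by auto
  show "\<exists>A\<in>components (sphere 0 1 - K). \<forall>\<^sub>F t in at_right 0. z * cis t \<in> A"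
    using A e(1) by (intro bexI[of _ A] eventually_at_rightI[of 0 e]) (auto simp: image_subset_iff)
  show "\<exists>A\<in>components (sphere 0 1 - K). \<forall>\<^sub>F t in at_left 0. z * cis t \<in> A"
    using B e(1) by (intro bexI[of _ B] eventually_at_leftI[of "-e" 0]) (auto simp: image_subset_iff)
qed

lemma component_open_on_circle:
  assumes "finite K" "A \<in> components (sphere 0 1 - K)" "z \<in> A"
  shows "\<forall>\<^sub>F t in nhds 0. z * cis t \<in> A"
proof -
  have z: "z \<in> sphere 0 1 - K"
    using assms(2,3) in_components_subset by blast
  then obtain e where e: "e > 0" "\<And>t. t \<noteq> 0 \<Longrightarrow> \<bar>t\<bar> < e \<Longrightarrow> z * cis t \<in> sphere 0 1 - K"
    using eventually_avoids_finite[OF assms(1), of z] by auto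
  have "(\<lambda>t. z * cis t) ` {-e<..<e} \<subseteq> A"
  proof (rule components_maximal[OF assms(2)])
    show "connected ((\<lambda>t. z * cis t) ` {-e<..<e})"
      by (intro connected_continuous_image continuous_intros) simp
    show "(\<lambda>t. z * cis t) ` {-e<..<e} \<subseteq> sphere 0 1 - K"
    proof (rule image_subsetI)
      fix t assume "t \<in> {-e<..<e}"
      then have "\<bar>t\<bar> < e" by (auto simp: abs_less_iff)
      then show "z * cis t \<in> sphere 0 1 - K"
        using e(2)[of t] z by (cases "t = 0") simp_all
    qed
    have "z \<in> (\<lambda>t. z * cis t) ` {-e<..<e}"
      using e(1) by (intro image_eqI[of _ _ 0]) auto
    then show "A \<inter> (\<lambda>t. z * cis t) ` {-e<..<e} \<noteq> {}"
      using assms(3) by blast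
  qed
  then show ?thesis
    unfolding eventually_nhds_metric using e(1)
    by (intro exI[of _ e]) (auto simp: dist_real_def abs_less_iff image_subset_iff)
qed

section \<open>Crossing indices and colorings\<close>

definition crossing_index :: "diagram \<Rightarrow> nat \<Rightarrow> int" where
  "crossing_index D i = (\<Sum>(p, q)\<in>over D. of_bool (fst p = i) - of_bool (fst q = i))"

definition cut_sign :: "diagram \<Rightarrow> param \<Rightarrow> int" where
  "cut_sign D p = of_bool (p \<in> fst ` over D) - of_bool (p \<in> snd ` over D)"

section \<open>Crossing passages and cut points\<close>

lemma over_crossing:
  assumes "virtual_link_diagram D" "(p, q) \<in> over D"
  shows "p \<in> params D" "q \<in> params D" "p \<noteq> q" "pt D p = pt D q" "(q, p) \<notin> over D"
    "{p, q} \<in> double_points D"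
proof -
  show *: "(q, p) \<notin> over D" "{p, q} \<in> double_points D"
    using assms unfolding virtual_link_diagram_def by blast+
  then obtain p' q' where "p' \<in> params D" "q' \<in> params D" "p' \<noteq> q'" "pt D p' = pt D q'" "{p, q} = {p', q'}"
    unfolding double_points_def by blast
  then show "p \<in> params D" "q \<in> params D" "p \<noteq> q" "pt D p = pt D q"
    by (auto simp: doubleton_eq_iff)
qed

lemma no_triple_point:
  assumes "virtual_link_diagram D" "p \<in> params D" "q \<in> params D" "r \<in> params D"
    "pt D p = pt D q" "pt D q = pt D r"
  shows "p = q \<or> q = r \<or> p = r"
  using assms unfolding virtual_link_diagram_def by blast

text \<open>A passage taking part in two crossings would put three parameters at one point of the
  plane, so two of them coincide. For the third claim this coincidence produces a crossing listed in
  both orders, against the asymmetry of \<open>over\<close>.\<close>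

lemma inj_on_over:
  assumes D: "virtual_link_diagram D"
  shows "inj_on fst (over D)" "inj_on snd (over D)" "fst ` over D \<inter> snd ` over D = {}"
proof -
  note * = over_crossing[OF D]
  have "q = r" if "(p, q) \<in> over D" "(p, r) \<in> over D" for p q r
    using that by (metis no_triple_point[OF D] *)
  then show "inj_on fst (over D)"
    by (auto simp: inj_on_def)
  have "q = r" if "(q, p) \<in> over D" "(r, p) \<in> over D" for p q r
    using that by (metis no_triple_point[OF D] *)
  then show "inj_on snd (over D)"
    by (auto simp: inj_on_def)
  have False if "(p, q) \<in> over D" "(r, p) \<in> over D" for p q r
    using that by (metis no_triple_point[OF D] *)
  then show "fst ` over D \<inter> snd ` over D = {}"
    by auto
qed

lemma finite_over:
  assumes D: "virtual_link_diagram D"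
  shows "finite (over D)"
proof (rule inj_on_finite)
  show "inj_on (\<lambda>(p, q). {p, q}) (over D)"
    using over_crossing(5)[OF D] by (fastforce intro!: inj_onI simp: doubleton_eq_iff)
  show "(\<lambda>(p, q). {p, q}) ` over D \<subseteq> double_points D"
    using over_crossing(6)[OF D] by auto
  show "finite (double_points D)"
    using D unfolding virtual_link_diagram_def by blast
qed

lemma Union_real_crossings: "\<Union> (real_crossings D) = fst ` over D \<union> snd ` over D"
proof -
  have "x \<in> \<Union> (real_crossings D) \<longleftrightarrow> (\<exists>c\<in>over D. x = fst c \<or> x = snd c)" for x
    unfolding real_crossings_def Bex_def split_paired_Ex[of "\<lambda>c. c \<in> over D \<and> _ c"] fst_conv snd_conv
    by blast
  then show ?thesis
    by (simp only: set_eq_iff Un_iff image_iff) blast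
qed

lemma cuts_eq: "cuts D i = {z. (i, z) \<in> fst ` over D} \<union> {z. (i, z) \<in> snd ` over D}"
  by (simp add: cuts_def Union_real_crossings Collect_disj_eq)

lemma finite_cuts:
  assumes "virtual_link_diagram D"
  shows "finite (cuts D i)"
proof -
  have "finite (Pair i -` (fst ` over D)) \<and> finite (Pair i -` (snd ` over D))"
    using finite_over[OF assms] by (auto intro!: finite_vimageI simp: inj_on_def)
  then show ?thesis
    unfolding cuts_eq by (simp add: vimage_def)
qed

lemma cuts_subset:
  assumes "virtual_link_diagram D"
  shows "cuts D i \<subseteq> sphere 0 1"
proof -
  have "\<Union> (real_crossings D) \<subseteq> params D"
    unfolding Union_real_crossings using over_crossing(1,2)[OF assms] by auto
  then show ?thesis
    unfolding cuts_def params_def by blast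
qed

lemma cut_sign_eq_0: "z \<notin> cuts D i \<Longrightarrow> cut_sign D (i, z) = 0"
  by (simp add: cut_sign_def cuts_eq)

lemma cut_sign_over:
  assumes "virtual_link_diagram D" "(p, q) \<in> over D"
  shows "cut_sign D p = 1" "cut_sign D q = -1"
proof -
  have "p \<in> fst ` over D" "q \<in> snd ` over D"
    using rev_image_eqI[OF assms(2), of p fst] rev_image_eqI[OF assms(2), of q snd] by simp_all
  moreover from this have "p \<notin> snd ` over D" "q \<notin> fst ` over D"
    using inj_on_over(3)[OF assms(1)] by blast+
  ultimately show "cut_sign D p = 1" "cut_sign D q = -1"
    unfolding cut_sign_def by simp_all
qed

text \<open>The same count organized by cut points instead of crossings. It rests on the fact that a
  cut point determines its crossing and its role there.\<close>

lemma sum_cut_sign: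
  assumes D: "virtual_link_diagram D"
  shows "(\<Sum>z\<in>cuts D i. cut_sign D (i, z)) = crossing_index D i"
proof -
  note fin = finite_over[OF D] finite_cuts[OF D]
  \<comment> \<open>Here \<open>f\<close> stands for \<open>fst\<close> or \<open>snd\<close>, which
    treats over- and under-passages at once.\<close>
  have *: "(\<Sum>z\<in>cuts D i. of_bool ((i, z) \<in> f ` over D)) = (\<Sum>x\<in>over D. of_bool (fst (f x) = i) :: int)"
    if f: "inj_on f (over D)" "f ` over D \<subseteq> \<Union> (real_crossings D)" for f :: "param \<times> param \<Rightarrow> param"
  proof -
    have "bij_betw (\<lambda>x. snd (f x)) {x \<in> over D. fst (f x) = i} {z \<in> cuts D i. (i, z) \<in> f ` over D}"
      unfolding bij_betw_def
    proof
      show "inj_on (\<lambda>x. snd (f x)) {x \<in> over D. fst (f x) = i}"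
        using f(1) by (auto simp: inj_on_def prod_eq_iff)
      show "(\<lambda>x. snd (f x)) ` {x \<in> over D. fst (f x) = i} = {z \<in> cuts D i. (i, z) \<in> f ` over D}"
      proof (intro equalityI subsetI)
        fix z assume "z \<in> (\<lambda>x. snd (f x)) ` {x \<in> over D. fst (f x) = i}"
        then obtain x where x: "x \<in> over D" "f x = (i, z)"
          by (auto simp: prod_eq_iff)
        then have "(i, z) \<in> f ` over D"
          by (intro image_eqI[of _ _ x]) simp_all
        moreover from this have "z \<in> cuts D i"
          unfolding cuts_def using subsetD[OF f(2)] by simp
        ultimately show "z \<in> {z \<in> cuts D i. (i, z) \<in> f ` over D}"
          by simp
      next
        fix z assume "z \<in> {z \<in> cuts D i. (i, z) \<in> f ` over D}"
        then obtain x where x: "x \<in> over D" "f x = (i, z)"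
          by force
        then show "z \<in> (\<lambda>x. snd (f x)) ` {x \<in> over D. fst (f x) = i}"
          by (intro image_eqI[of _ _ x]) simp_all
      qed
    qed
    then show ?thesis
      using fin by (auto simp: sum.If_cases of_bool_def Int_def dest: bij_betw_same_card)
  qed
  have "fst ` over D \<subseteq> \<Union> (real_crossings D)" "snd ` over D \<subseteq> \<Union> (real_crossings D)"
    unfolding Union_real_crossings by blast+
  then show ?thesis
    unfolding cut_sign_def crossing_index_def sum_subtractf case_prod_beta
    using * inj_on_over[OF D] by simp
qed

text \<open>
  A right-continuous step function on each component which increases by \<open>cut_sign\<close> at every
  cut point, at the price of a drop by \<open>crossing_index\<close> at the base point \<open>1\<close>, where
  \<open>Arg2pi\<close> jumps back to \<open>0\<close>.
\<close>

definition step_potential :: "diagram \<Rightarrow> param \<Rightarrow> int" where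
  "step_potential D p =
     (\<Sum>a\<in>cuts D (fst p). cut_sign D (fst p, a) * of_bool (Arg2pi a \<le> Arg2pi (snd p)))"

lemma step_potential_right:
  assumes "virtual_link_diagram D" "norm z = 1"
  shows "\<forall>\<^sub>F t in at_right 0. step_potential D (i, z * cis t) = step_potential D (i, z)"
proof -
  have "\<forall>\<^sub>F t in at_right 0. \<forall>a\<in>cuts D i. Arg2pi a \<le> Arg2pi (z * cis t) \<longleftrightarrow> Arg2pi a \<le> Arg2pi z"
    using angle_step_right[OF assms(2)] finite_cuts[OF assms(1)] by (simp add: eventually_ball_finite)
  then show ?thesis
    by eventually_elim (simp add: step_potential_def)
qed

text \<open>At \<open>z = 1\<close> the indicators of all cut points gain 1 together, and their
  signs add up to the crossing index.\<close>

lemma step_potential_left: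
  assumes D: "virtual_link_diagram D" and z: "norm z = 1"
  shows "\<forall>\<^sub>F t in at_left 0. step_potential D (i, z * cis t) =
     step_potential D (i, z) - cut_sign D (i, z) + of_bool (z = 1) * crossing_index D i"
proof -
  note fin = finite_cuts[OF D, of i]
  have "\<forall>\<^sub>F t in at_left 0. \<forall>a\<in>cuts D i. of_bool (Arg2pi a \<le> Arg2pi (z * cis t)) =
           of_bool (Arg2pi a \<le> Arg2pi z) - of_bool (a = z) + (of_bool (z = 1) :: int)"
    using cuts_subset[OF D, of i] by (intro eventually_ball_finite ballI fin angle_step_left z) auto
  then show ?thesis
  proof eventually_elim
    case (elim t)
    have "step_potential D (i, z * cis t) = (\<Sum>a\<in>cuts D i. cut_sign D (i, a) *
        (of_bool (Arg2pi a \<le> Arg2pi z) - of_bool (a = z) + of_bool (z = 1)))"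
      unfolding step_potential_def using elim by simp
    also have "\<dots> = step_potential D (i, z) - (\<Sum>a\<in>cuts D i. cut_sign D (i, a) * of_bool (a = z))
        + of_bool (z = 1) * crossing_index D i"
      unfolding step_potential_def sum_cut_sign[OF D, symmetric]
      by (simp add: algebra_simps sum.distrib sum_subtractf sum_distrib_left)
    also have "(\<Sum>a\<in>cuts D i. cut_sign D (i, a) * of_bool (a = z)) = cut_sign D (i, z)"
      using fin cut_sign_eq_0[of z D i] by (simp add: of_bool_def if_distrib cong: if_cong)
    finally show ?case .
  qed
qed

section \<open>The semi-arcs adjacent to a parameter\<close>

definition arc_before :: "diagram \<Rightarrow> param \<Rightarrow> nat \<times> complex set" where
  "arc_before D p = (THE a. a \<in> semi_arcs D \<and> arc_into a p)"

definition arc_after :: "diagram \<Rightarrow> param \<Rightarrow> nat \<times> complex set" where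
  "arc_after D p = (THE a. a \<in> semi_arcs D \<and> arc_out_of a p)"

lemma semi_arcs_meet:
  assumes "(i, A) \<in> semi_arcs D" "(i, B) \<in> semi_arcs D" "\<forall>\<^sub>F t in F. g t \<in> A" "\<forall>\<^sub>F t in F. g t \<in> B"
    "F \<noteq> bot"
  shows "A = B"
proof -
  have "\<forall>\<^sub>F t in F. g t \<in> A \<inter> B"
    using assms(3,4) by eventually_elim simp
  then have "A \<inter> B \<noteq> {}"
    using eventually_happens'[OF assms(5)] by blast
  then show ?thesis
    using components_eq[of A _ B] assms(1,2) unfolding semi_arcs_def by blast
qed

lemma arc_before_unique:
  assumes "virtual_link_diagram D" "p \<in> params D"
  shows "\<exists>!a. a \<in> semi_arcs D \<and> arc_into a p"
proof -
  obtain i z where p: "p = (i, z)" "i < comps D" "norm z = 1"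
    using assms(2) unfolding params_def by auto
  obtain A where A: "A \<in> components (sphere 0 1 - cuts D i)" "\<forall>\<^sub>F t in at_left 0. z * cis t \<in> A"
    using component_adjacent(2)[OF finite_cuts[OF assms(1)] p(3)] by blast
  then have "(i, A) \<in> semi_arcs D \<and> arc_into (i, A) p"
    using p by (simp add: semi_arcs_def arc_into_def)
  moreover have "a = b" if "a \<in> semi_arcs D \<and> arc_into a p" "b \<in> semi_arcs D \<and> arc_into b p" for a b
    using that semi_arcs_meet[of i "snd a" D "snd b" "\<lambda>t. z * cis t" "at_left 0"] p
    unfolding arc_into_def by (cases a, cases b) (auto simp: trivial_limit_at_left_real)
  ultimately show ?thesis by blast
qed

lemma arc_after_unique:
  assumes "virtual_link_diagram D" "p \<in> params D"
  shows "\<exists>!a. a \<in> semi_arcs D \<and> arc_out_of a p"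
proof -
  obtain i z where p: "p = (i, z)" "i < comps D" "norm z = 1"
    using assms(2) unfolding params_def by auto
  obtain A where A: "A \<in> components (sphere 0 1 - cuts D i)" "\<forall>\<^sub>F t in at_right 0. z * cis t \<in> A"
    using component_adjacent(1)[OF finite_cuts[OF assms(1)] p(3)] by blast
  then have "(i, A) \<in> semi_arcs D \<and> arc_out_of (i, A) p"
    using p by (simp add: semi_arcs_def arc_out_of_def)
  moreover have "a = b" if "a \<in> semi_arcs D \<and> arc_out_of a p" "b \<in> semi_arcs D \<and> arc_out_of b p" for a b
    using that semi_arcs_meet[of i "snd a" D "snd b" "\<lambda>t. z * cis t" "at_right 0"] p
    unfolding arc_out_of_def by (cases a, cases b) (auto simp: trivial_limit_at_right_real)
  ultimately show ?thesis by blast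
qed

lemma arc_before:
  assumes "virtual_link_diagram D" "p \<in> params D"
  shows "arc_before D p \<in> semi_arcs D" "arc_into (arc_before D p) p"
    and "\<And>a. a \<in> semi_arcs D \<Longrightarrow> arc_into a p \<Longrightarrow> arc_before D p = a"
  unfolding arc_before_def
  using theI'[OF arc_before_unique[OF assms]]
  by (blast, blast) (intro the1_equality[OF arc_before_unique[OF assms]] conjI)

lemma arc_after:
  assumes "virtual_link_diagram D" "p \<in> params D"
  shows "arc_after D p \<in> semi_arcs D" "arc_out_of (arc_after D p) p"
    and "\<And>a. a \<in> semi_arcs D \<Longrightarrow> arc_out_of a p \<Longrightarrow> arc_after D p = a"
  unfolding arc_after_def
  using theI'[OF arc_after_unique[OF assms]]
  by (blast, blast) (intro the1_equality[OF arc_after_unique[OF assms]] conjI)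

lemma arc_of_interior_point:
  assumes D: "virtual_link_diagram D" and a: "(i, A) \<in> semi_arcs D" "z \<in> A"
  shows "arc_before D (i, z) = (i, A)" "arc_after D (i, z) = (i, A)"
proof -
  have A: "A \<in> components (sphere 0 1 - cuts D i)" "i < comps D"
    using a unfolding semi_arcs_def by auto
  then have p: "(i, z) \<in> params D"
    using a(2) in_components_subset unfolding params_def by blast
  have "\<forall>\<^sub>F t in at 0. z * cis t \<in> A"
    using component_open_on_circle[OF finite_cuts[OF D] A(1) a(2)]
    unfolding eventually_at_filter by (auto elim: eventually_mono)
  then have "arc_into (i, A) (i, z)" "arc_out_of (i, A) (i, z)"
    unfolding arc_into_def arc_out_of_def eventually_at_split by simp_all
  with a(1) show "arc_before D (i, z) = (i, A)" "arc_after D (i, z) = (i, A)"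
    using arc_before(3)[OF D p] arc_after(3)[OF D p] by auto
qed

text \<open>This makes the color of \<open>arc_after\<close> a right-continuous function of the
  parameter whose left limit is the color of \<open>arc_before\<close>, the form in which it can be
  compared with the potential.\<close>

lemma arc_after_near:
  assumes D: "virtual_link_diagram D" and p: "(i, z) \<in> params D"
  shows "\<forall>\<^sub>F t in at_right 0. arc_after D (i, z * cis t) = arc_after D (i, z)"
    and "\<forall>\<^sub>F t in at_left 0. arc_after D (i, z * cis t) = arc_before D (i, z)"
proof -
  obtain A B where A: "arc_after D (i, z) = (i, A)" and B: "arc_before D (i, z) = (i, B)"
    using arc_after(2)[OF D p] arc_before(2)[OF D p]
    unfolding arc_into_def arc_out_of_def by (metis fst_conv prod.collapse)
  have "\<forall>\<^sub>F t in at_right 0. z * cis t \<in> A" "\<forall>\<^sub>F t in at_left 0. z * cis t \<in> B"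
    using arc_after(2)[OF D p] arc_before(2)[OF D p] A B
    unfolding arc_into_def arc_out_of_def by auto
  moreover have "(i, A) \<in> semi_arcs D" "(i, B) \<in> semi_arcs D"
    using arc_after(1)[OF D p] arc_before(1)[OF D p] A B by auto
  ultimately show "\<forall>\<^sub>F t in at_right 0. arc_after D (i, z * cis t) = arc_after D (i, z)"
    "\<forall>\<^sub>F t in at_left 0. arc_after D (i, z * cis t) = arc_before D (i, z)"
    unfolding A B by (auto elim!: eventually_mono dest: arc_of_interior_point[OF D])
qed

lemma arc_nonempty:
  assumes "(i, A) \<in> semi_arcs D"
  obtains z where "z \<in> A" "norm z = 1" "z \<notin> cuts D i" "(i, z) \<in> params D"
proof -
  have A: "A \<in> components (sphere 0 1 - cuts D i)" "i < comps D"
    using assms unfolding semi_arcs_def by auto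
  then obtain z where "z \<in> A" "z \<in> sphere 0 1 - cuts D i"
    using in_components_nonempty in_components_subset by blast
  with A(2) show ?thesis
    by (intro that[of z]) (auto simp: params_def)
qed

text \<open>Both crossing rules become one jump condition, imposed at every parameter. Away from the
  cut points it holds trivially: the arcs before and after coincide and the sign is 0.\<close>

lemma up_down_colorings_iff:
  assumes D: "virtual_link_diagram D"
  shows "C \<in> up_down_colorings n D \<longleftrightarrow> C \<in> semi_arcs D \<rightarrow>\<^sub>E {0..<int n} \<and>
     (\<forall>p\<in>params D. [C (arc_before D p) = C (arc_after D p) - cut_sign D p] (mod int n))"
    (is "_ \<longleftrightarrow> ?E \<and> ?R")
proof -
  have "(\<forall>(p, q)\<in>over D.
         \<forall>o1\<in>semi_arcs D. \<forall>o2\<in>semi_arcs D. \<forall>u1\<in>semi_arcs D. \<forall>u2\<in>semi_arcs D.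
           arc_into o1 p \<and> arc_out_of o2 p \<and> arc_into u1 q \<and> arc_out_of u2 q \<longrightarrow>
             [C u2 = C u1 - 1] (mod int n) \<and> [C o2 = C o1 + 1] (mod int n)) \<longleftrightarrow>
     (\<forall>(p, q)\<in>over D. [C (arc_after D q) = C (arc_before D q) - 1] (mod int n) \<and>
        [C (arc_after D p) = C (arc_before D p) + 1] (mod int n))" (is "?L \<longleftrightarrow> ?M")
  proof -
    \<comment> \<open>The adjacent arcs exist and are unique, so the four quantifiers collapse for
      an arbitrary relation \<open>Q\<close>.\<close>
    have *: "(\<forall>o1\<in>semi_arcs D. \<forall>o2\<in>semi_arcs D. \<forall>u1\<in>semi_arcs D. \<forall>u2\<in>semi_arcs D.
           arc_into o1 p \<and> arc_out_of o2 p \<and> arc_into u1 q \<and> arc_out_of u2 q \<longrightarrow> Q o1 o2 u1 u2) \<longleftrightarrow>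
        Q (arc_before D p) (arc_after D p) (arc_before D q) (arc_after D q)"
      if "(p, q) \<in> over D" for p q Q
      using arc_before[OF D, of p] arc_before[OF D, of q] arc_after[OF D, of p] arc_after[OF D, of q]
        over_crossing(1,2)[OF D that]
      by metis
    show ?thesis
      by (rule ball_cong[OF HOL.refl], rename_tac x, case_tac x) (simp only: prod.case *)
  qed
  also have "?M \<longleftrightarrow> ?R"
  proof
    assume M: ?M
    show ?R
    proof
      fix p assume p: "p \<in> params D"
      consider x where "x \<in> over D" "p = fst x" | x where "x \<in> over D" "p = snd x"
        | "p \<notin> fst ` over D" "p \<notin> snd ` over D"
        by blast
      then show "[C (arc_before D p) = C (arc_after D p) - cut_sign D p] (mod int n)"
      proof cases
        case 1
        then have over: "(p, snd x) \<in> over D" by simp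
        with M have "[C (arc_after D p) = C (arc_before D p) + 1] (mod int n)"
          by blast
        then show ?thesis
          by (auto simp: cut_sign_over[OF D over] cong_iff_dvd_diff algebra_simps dvd_diff_commute)
      next
        case 2
        then have over: "(fst x, p) \<in> over D" by simp
        with M have "[C (arc_after D p) = C (arc_before D p) - 1] (mod int n)"
          by blast
        then show ?thesis
          by (auto simp: cut_sign_over[OF D over] cong_iff_dvd_diff algebra_simps dvd_diff_commute)
      next
        case 3
        obtain i z where iz: "p = (i, z)" by fastforce
        with p 3 have "z \<in> sphere 0 1 - cuts D i" "i < comps D"
          unfolding cuts_eq params_def by auto
        then obtain A where "(i, A) \<in> semi_arcs D" "z \<in> A"
          unfolding semi_arcs_def using Union_components by (metis (no_types) UnionE lessThan_iff mem_Sigma_iff)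
        then show ?thesis
          using 3 arc_of_interior_point[OF D] by (simp add: iz cut_sign_def)
      qed
    qed
  next
    assume R: ?R
    have "[C (arc_after D q) = C (arc_before D q) - 1] (mod int n) \<and>
        [C (arc_after D p) = C (arc_before D p) + 1] (mod int n)" if pq: "(p, q) \<in> over D" for p q
    proof -
      have "[C (arc_before D p) = C (arc_after D p) - 1] (mod int n)"
        "[C (arc_before D q) = C (arc_after D q) + 1] (mod int n)"
        using R over_crossing(1,2)[OF D pq] by (force simp: cut_sign_over[OF D pq])+
      then show ?thesis
        by (auto simp: cong_iff_dvd_diff algebra_simps dvd_diff_commute)
    qed
    then show ?M by blast
  qed
  finally show ?thesis
    unfolding up_down_colorings_def by simp
qed

text \<open>An arc contains no cut point, so the only possible jump of the potential inside it is
  the artificial one at the point 1, and that is a multiple of \<open>n\<close>.\<close>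

lemma potential_constant_on_arc:
  assumes D: "virtual_link_diagram D" and n: "int n dvd crossing_index D i"
    and A: "(i, A) \<in> semi_arcs D" "z \<in> A" "w \<in> A"
  shows "[step_potential D (i, z) = step_potential D (i, w)] (mod int n)"
proof -
  have sub: "A \<in> components (sphere 0 1 - cuts D i)"
    using A unfolding semi_arcs_def by auto
  have "(\<lambda>z. step_potential D (i, z) mod int n) constant_on A"
  proof (rule constant_on_connected_circle_subset)
    show "connected A" "A \<subseteq> sphere 0 1"
      using in_components_connected[OF sub] in_components_subset[OF sub] by auto
    fix z assume "z \<in> A"
    then have z: "norm z = 1" "cut_sign D (i, z) = 0"
      using in_components_subset[OF sub] by (auto intro!: cut_sign_eq_0)
    have "\<forall>\<^sub>F t in at_right 0. step_potential D (i, z * cis t) mod int n = step_potential D (i, z) mod int n"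
      using step_potential_right[OF D z(1), of i] by eventually_elim simp
    moreover
    have "\<forall>\<^sub>F t in at_left 0. step_potential D (i, z * cis t) mod int n = step_potential D (i, z) mod int n"
      using step_potential_left[OF D z(1), of i]
    proof eventually_elim
      case (elim t)
      then show ?case
        using n z(2) by (auto simp: mod_add_eq mod_eq_dvd_iff)
    qed
    ultimately show "\<forall>\<^sub>F t in at 0. step_potential D (i, z * cis t) mod int n = step_potential D (i, z) mod int n"
      unfolding eventually_at_split by simp
  qed
  then obtain c where "\<And>z. z \<in> A \<Longrightarrow> step_potential D (i, z) mod int n = c"
    unfolding constant_on_def by blast
  with A show ?thesis
    by (simp add: cong_def)
qed

lemma coloring_determined_by_potential:
  assumes D: "virtual_link_diagram D" and C: "C \<in> up_down_colorings n D" and i: "i < comps D"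
  shows "int n dvd crossing_index D i"
    and "norm z = 1 \<Longrightarrow> [C (arc_after D (i, z)) =
      C (arc_after D (i, 1)) + step_potential D (i, z) - step_potential D (i, 1)] (mod int n)"
proof -
  \<comment> \<open>In this difference the jumps at cut points cancel; only the artificial jump at 1
    can remain.\<close>
  define F where "F z = (C (arc_after D (i, z)) - step_potential D (i, z)) mod int n" for z
  have right: "\<forall>\<^sub>F t in at_right 0. F (z * cis t) = F z" if z: "norm z = 1" for z
  proof -
    have "(i, z) \<in> params D"
      using z i by (simp add: params_def)
    from arc_after_near(1)[OF D this] step_potential_right[OF D z, of i] show ?thesis
      by eventually_elim (simp add: F_def)
  qed
  have left: "\<forall>\<^sub>F t in at_left 0. [F (z * cis t) = F z - of_bool (z = 1) * crossing_index D i] (mod int n)"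
    if z: "norm z = 1" for z
  proof -
    have p: "(i, z) \<in> params D"
      using z i by (simp add: params_def)
    with C have C': "[C (arc_before D (i, z)) = C (arc_after D (i, z)) - cut_sign D (i, z)] (mod int n)"
      unfolding up_down_colorings_iff[OF D] by blast
    from arc_after_near(2)[OF D p] step_potential_left[OF D z, of i] show ?thesis
    proof eventually_elim
      case (elim t)
      have "[F (z * cis t) = C (arc_before D (i, z)) - (step_potential D (i, z) - cut_sign D (i, z) +
          of_bool (z = 1) * crossing_index D i)] (mod int n)"
        by (simp add: F_def elim cong_def)
      also have "[C (arc_before D (i, z)) - (step_potential D (i, z) - cut_sign D (i, z) +
            of_bool (z = 1) * crossing_index D i) =
          (C (arc_after D (i, z)) - cut_sign D (i, z)) - (step_potential D (i, z) - cut_sign D (i, z) +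
            of_bool (z = 1) * crossing_index D i)] (mod int n)"
        by (intro cong_diff C' cong_refl)
      also have "(C (arc_after D (i, z)) - cut_sign D (i, z)) - (step_potential D (i, z) - cut_sign D (i, z) +
            of_bool (z = 1) * crossing_index D i) =
          (C (arc_after D (i, z)) - step_potential D (i, z)) - of_bool (z = 1) * crossing_index D i"
        by simp
      also have "[\<dots> = F z - of_bool (z = 1) * crossing_index D i] (mod int n)"
        by (intro cong_diff cong_refl) (simp add: F_def cong_def)
      finally show ?case .
    qed
  qed
  have const: "F z = F 1" if "norm z = 1" for z
  proof (rule constant_on_circle[OF right _ that])
    fix z :: complex assume "norm z = 1" "z \<noteq> 1"
    with left[of z] show "\<forall>\<^sub>F t in at_left 0. F (z * cis t) = F z"
      by (auto simp: F_def cong_def)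
  qed
  \<comment> \<open>Just before 1 the function differs from \<open>F 1\<close> by the crossing index
    modulo \<open>n\<close>, yet it is constant on the whole circle; hence the index vanishes modulo
    \<open>n\<close>.\<close>
  obtain t where "[F (1 * cis t) = F 1 - of_bool (1 = (1 :: complex)) * crossing_index D i] (mod int n)"
    using eventually_happens'[OF trivial_limit_at_left_real left[OF norm_one]] by blast
  then show "int n dvd crossing_index D i"
    using const[of "cis t"] by (simp add: cong_iff_dvd_diff)
  assume "norm z = 1"
  then have "[C (arc_after D (i, z)) - step_potential D (i, z) =
      C (arc_after D (i, 1)) - step_potential D (i, 1)] (mod int n)"
    using const[of z] by (simp add: F_def cong_def)
  from cong_add[OF this cong_refl[of "step_potential D (i, z)"]]
  show "[C (arc_after D (i, z)) =
      C (arc_after D (i, 1)) + step_potential D (i, z) - step_potential D (i, 1)] (mod int n)"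
    by (simp add: algebra_simps)
qed

text \<open>Every arc is the arc after any of its own points, so its color is the color after the
  base point plus a difference of potentials. Congruent values in \<open>{0..<int n}\<close> are
  equal.\<close>

lemma colorings_eqI:
  assumes D: "virtual_link_diagram D" and C: "C \<in> up_down_colorings n D" "C' \<in> up_down_colorings n D"
    and eq: "\<And>i. i < comps D \<Longrightarrow> C (arc_after D (i, 1)) = C' (arc_after D (i, 1))"
  shows "C = C'"
proof (rule PiE_ext)
  show ran: "C \<in> semi_arcs D \<rightarrow>\<^sub>E {0..<int n}" "C' \<in> semi_arcs D \<rightarrow>\<^sub>E {0..<int n}"
    using C up_down_colorings_iff[OF D] by auto
  fix a assume a: "a \<in> semi_arcs D"
  obtain i A where iA: "a = (i, A)" by fastforce
  with a obtain z where z: "z \<in> A" "norm z = 1" "(i, z) \<in> params D"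
    using arc_nonempty[of i A D] by blast
  then have i: "i < comps D"
    by (simp add: params_def)
  have "arc_after D (i, z) = a"
    using arc_of_interior_point(2)[OF D _ z(1)] a iA by simp
  then have "[C a = C' a] (mod int n)"
    using coloring_determined_by_potential(2)[OF D C(1) i z(2)]
      coloring_determined_by_potential(2)[OF D C(2) i z(2)] eq[OF i]
    by (metis cong_sym cong_trans)
  moreover have "C a \<in> {0..<int n}" "C' a \<in> {0..<int n}"
    using ran a by auto
  ultimately show "C a = C' a"
    by (simp add: cong_def)
qed

lemma coloring_exists:
  assumes D: "virtual_link_diagram D" and n: "n > 0"
    and dvd: "\<And>i. i < comps D \<Longrightarrow> int n dvd crossing_index D i"
    and c: "\<And>i. i < comps D \<Longrightarrow> c i \<in> {0..<int n}"
  obtains C where "C \<in> up_down_colorings n D" "\<And>i. i < comps D \<Longrightarrow> C (arc_after D (i, 1)) = c i"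
proof -
  \<comment> \<open>The base point may be a cut point, in which case its potential is not 0;
    subtracting it makes the color after 1 equal to \<open>c i\<close>.\<close>
  define color where "color i z = (c i + step_potential D (i, z) - step_potential D (i, 1)) mod int n" for i z
  \<comment> \<open>The chosen point is immaterial, because the potential is constant modulo
    \<open>n\<close> on each arc.\<close>
  define C where "C = (\<lambda>(i, A)\<in>semi_arcs D. color i (SOME z. z \<in> A))"
  have C_eq: "C (i, A) = color i z" if "(i, A) \<in> semi_arcs D" "z \<in> A" for i A z
  proof -
    have "[step_potential D (i, SOME z. z \<in> A) = step_potential D (i, z)] (mod int n)"
      using that someI[of "\<lambda>z. z \<in> A" z]
      by (intro potential_constant_on_arc[OF D dvd that(1)]) (auto simp: semi_arcs_def)
    then have "[c i + step_potential D (i, SOME z. z \<in> A) - step_potential D (i, 1) =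
        c i + step_potential D (i, z) - step_potential D (i, 1)] (mod int n)"
      by (intro cong_add cong_diff cong_refl)
    then show ?thesis
      using that by (simp add: C_def color_def cong_def)
  qed
  have after: "C (arc_after D (i, z)) = color i z"
    and before: "[C (arc_before D (i, z)) = color i z - cut_sign D (i, z)] (mod int n)"
    if p: "(i, z) \<in> params D" for i z
  proof -
    have z: "norm z = 1" and i: "i < comps D"
      using p by (auto simp: params_def)
    obtain A B where A: "arc_after D (i, z) = (i, A)" and B: "arc_before D (i, z) = (i, B)"
      using arc_after(2)[OF D p] arc_before(2)[OF D p]
      unfolding arc_into_def arc_out_of_def by (metis fst_conv prod.collapse)
    have SA: "(i, A) \<in> semi_arcs D" "(i, B) \<in> semi_arcs D"
      using arc_after(1)[OF D p] arc_before(1)[OF D p] A B by auto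
    have "\<forall>\<^sub>F t in at_right 0. z * cis t \<in> A"
      using arc_after(2)[OF D p] A by (simp add: arc_out_of_def)
    \<comment> \<open>The claim no longer mentions \<open>t\<close>: nearby points of
      \<open>A\<close> serve to evaluate the color of the arc, and a proposition that holds
      eventually along a nontrivial filter holds.\<close>
    with step_potential_right[OF D z, of i] have "\<forall>\<^sub>F t in at_right (0::real). C (i, A) = color i z"
      by eventually_elim (simp add: C_eq[OF SA(1)] color_def)
    then show "C (arc_after D (i, z)) = color i z"
      by (simp add: A trivial_limit_at_right_real)
    have "\<forall>\<^sub>F t in at_left 0. z * cis t \<in> B"
      using arc_before(2)[OF D p] B by (simp add: arc_into_def)
    with step_potential_left[OF D z, of i]
    have "\<forall>\<^sub>F t in at_left (0::real). [C (i, B) = color i z - cut_sign D (i, z)] (mod int n)"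
    proof eventually_elim
      case (elim t)
      have "C (i, B) = (c i + (step_potential D (i, z) - cut_sign D (i, z) + of_bool (z = 1) * crossing_index D i)
          - step_potential D (i, 1)) mod int n"
        using elim by (simp add: C_eq[OF SA(2)] color_def)
      also have "[\<dots> = c i + (step_potential D (i, z) - cut_sign D (i, z) + of_bool (z = 1) * crossing_index D i)
          - step_potential D (i, 1)] (mod int n)"
        by (simp add: cong_def)
      \<comment> \<open>The wrap-around term is a multiple of \<open>n\<close> and is replaced by
        0.\<close>
      also have "[c i + (step_potential D (i, z) - cut_sign D (i, z) + of_bool (z = 1) * crossing_index D i)
            - step_potential D (i, 1) =
          c i + (step_potential D (i, z) - cut_sign D (i, z) + 0) - step_potential D (i, 1)] (mod int n)"
        using dvd[OF i] by (intro cong_add cong_diff cong_refl) (auto simp: cong_0_iff)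
      also have "c i + (step_potential D (i, z) - cut_sign D (i, z) + 0) - step_potential D (i, 1) =
          (c i + step_potential D (i, z) - step_potential D (i, 1)) - cut_sign D (i, z)"
        by simp
      also have "[\<dots> = color i z - cut_sign D (i, z)] (mod int n)"
        by (intro cong_diff cong_refl) (simp add: color_def cong_def)
      finally show ?case .
    qed
    then show "[C (arc_before D (i, z)) = color i z - cut_sign D (i, z)] (mod int n)"
      by (simp add: B trivial_limit_at_left_real)
  qed
  have "C \<in> semi_arcs D \<rightarrow>\<^sub>E {0..<int n}"
    using n by (auto simp: C_def color_def)
  then have "C \<in> up_down_colorings n D"
    unfolding up_down_colorings_iff[OF D] using after before by auto
  moreover have "C (arc_after D (i, 1)) = c i" if "i < comps D" for i
    using after[of i 1] c[OF that] that by (simp add: params_def color_def)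
  ultimately show ?thesis
    by (rule that)
qed

theorem card_up_down_colorings:
  assumes D: "virtual_link_diagram D" and n: "n > 0"
  shows "card (up_down_colorings n D) =
    (if \<forall>i<comps D. int n dvd crossing_index D i then n ^ comps D else 0)"
proof (cases "\<forall>i<comps D. int n dvd crossing_index D i")
  case True
  let ?I = "{..<comps D}" and ?r = "\<lambda>C. \<lambda>i\<in>{..<comps D}. C (arc_after D (i, 1))"
  have "bij_betw ?r (up_down_colorings n D) (?I \<rightarrow>\<^sub>E {0..<int n})"
    unfolding bij_betw_def
  proof (intro conjI equalityI subsetI)
    show "inj_on ?r (up_down_colorings n D)"
    proof (rule inj_onI)
      fix C C' assume CC': "C \<in> up_down_colorings n D" "C' \<in> up_down_colorings n D" and eq: "?r C = ?r C'"
      show "C = C'"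
      proof (rule colorings_eqI[OF D CC'])
        fix i assume "i < comps D"
        then show "C (arc_after D (i, 1)) = C' (arc_after D (i, 1))"
          using fun_cong[OF eq, of i] by simp
      qed
    qed
  next
    fix c assume "c \<in> ?r ` up_down_colorings n D"
    then obtain C where c: "c = ?r C" and C: "C \<in> semi_arcs D \<rightarrow>\<^sub>E {0..<int n}"
      using up_down_colorings_iff[OF D] by auto
    have "C (arc_after D (i, 1)) \<in> {0..<int n}" if "i < comps D" for i
      using that by (intro PiE_mem[OF C] arc_after(1)[OF D]) (simp add: params_def)
    then show "c \<in> ?I \<rightarrow>\<^sub>E {0..<int n}"
      unfolding c by auto
  next
    fix c assume c: "c \<in> ?I \<rightarrow>\<^sub>E {0..<int n}"
    have "c i \<in> {0..<int n}" if "i < comps D" for i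
      using that by (intro PiE_mem[OF c]) simp
    then obtain C where C: "C \<in> up_down_colorings n D" "\<And>i. i < comps D \<Longrightarrow> C (arc_after D (i, 1)) = c i"
      using coloring_exists[OF D n, of c] True by metis
    have "c = ?r C"
    proof
      fix i
      show "c i = ?r C i"
        by (cases "i < comps D") (simp_all add: C(2) PiE_arb[OF c])
    qed
    with C(1) show "c \<in> ?r ` up_down_colorings n D"
      by blast
  qed
  then have "card (up_down_colorings n D) = card (?I \<rightarrow>\<^sub>E {0..<int n})"
    by (rule bij_betw_same_card)
  with True show ?thesis
    by (simp add: card_PiE)
next
  case False
  then have "up_down_colorings n D = {}"
    using coloring_determined_by_potential(1)[OF D] by blast
  with False show ?thesis by (simp only: card.empty if_False)
qed

section \<open>Behavior of the indices under moves and isotopies\<close>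

text \<open>The complement in \<open>over D\<close> of the set that \<open>local_change\<close>
  keeps fixed. Testing the over-parameter suffices, since both parameters of a crossing have the
  same image.\<close>

definition crossings_inside :: "diagram \<Rightarrow> (real ^ 2) set \<Rightarrow> (param \<times> param) set" where
  "crossings_inside D B = {(p, q) \<in> over D. pt D p \<in> B}"

lemma crossings_inside_subset:
  assumes D: "virtual_link_diagram D" and pq: "(p, q) \<in> crossings_inside D B"
  shows "{p, q} \<in> crossings_in D B" "{p, q} \<in> real_crossings D" "(p, q) \<in> over D"
proof -
  have "(p, q) \<in> over D" "pt D p \<in> B"
    using pq by (auto simp: crossings_inside_def)
  moreover from this have "pt D q \<in> B"
    using over_crossing(4)[OF D] by metis
  ultimately show "{p, q} \<in> crossings_in D B" "(p, q) \<in> over D"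
    using over_crossing(6)[OF D, of p q] by (auto simp: crossings_in_def)
  then show "{p, q} \<in> real_crossings D"
    unfolding real_crossings_def by blast
qed

lemma mem_crossings_insideI:
  "(p, q) \<in> over D \<Longrightarrow> {p, q} \<in> crossings_in D B \<Longrightarrow> (p, q) \<in> crossings_inside D B"
  by (auto simp: crossings_inside_def crossings_in_def)

text \<open>The index splits into contributions from outside and inside the disk, and the outside
  crossings are the same set of parameter pairs in both diagrams.\<close>

lemma crossing_index_local_change:
  assumes D: "virtual_link_diagram D" "virtual_link_diagram D'" and lc: "local_change B ss D D'"
    and eq: "\<And>i. (\<Sum>(p, q)\<in>crossings_inside D B. of_bool (fst p = i) - of_bool (fst q = i) :: int) =
      (\<Sum>(p, q)\<in>crossings_inside D' B. of_bool (fst p = i) - of_bool (fst q = i))"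
  shows "crossing_index D = crossing_index D'"
proof
  fix i
  let ?s = "sum (\<lambda>(p :: param, q :: param). of_bool (fst p = i) - of_bool (fst q = i) :: int)"
  let ?out = "\<lambda>D. {(p, q) \<in> over D. pt D p \<notin> B}"
  have split: "crossing_index E i = ?s (?out E) + ?s (crossings_inside E B)"
    if "virtual_link_diagram E" for E
  proof -
    have "?s (over E) = ?s (?out E \<union> crossings_inside E B)"
      by (rule arg_cong[of _ _ ?s]) (auto simp: crossings_inside_def)
    also have "\<dots> = ?s (?out E) + ?s (crossings_inside E B)"
    proof (rule sum.union_disjoint)
      show "finite (?out E)" "finite (crossings_inside E B)"
        by (rule finite_subset[OF _ finite_over[OF that]]; auto simp: crossings_inside_def)+
    qed (auto simp: crossings_inside_def)
    finally show ?thesis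
      unfolding crossing_index_def .
  qed
  show "crossing_index D i = crossing_index D' i"
    using lc unfolding split[OF D(1)] split[OF D(2)] local_change_def eq by simp
qed

lemma fst_pos [simp]: "fst (pos s t) = fst s"
  by (cases s) simp

lemma adds_kink_index:
  assumes D: "virtual_link_diagram D" "virtual_link_diagram D'" and "adds_kink D D' c"
  shows "comps D = comps D'" "crossing_index D = crossing_index D'"
proof -
  obtain B s t u where lc: "local_change B [s] D D'" and c: "c = {pos s t, pos s u}"
    and cr: "crossings_in D B = {}" "crossings_in D' B = {c}"
    using assms(3) unfolding adds_kink_def by blast
  show "comps D = comps D'"
    using lc by (simp add: local_change_def)
  have "crossings_inside D B = {}"
    using crossings_inside_subset(1)[OF D(1)] cr(1) by (metis all_not_in_conv surj_pair)
  \<comment> \<open>Both passages lie on the single strand \<open>s\<close>, whichever of them is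
    over, so the crossing contributes 0 if it is real and is not listed if it is virtual.\<close>
  moreover have "fst p = fst q" if "(p, q) \<in> crossings_inside D' B" for p q
    using crossings_inside_subset(1)[OF D(2) that] cr(2) c by (auto simp: doubleton_eq_iff)
  then have "(\<Sum>(p, q)\<in>crossings_inside D' B. of_bool (fst p = i) - of_bool (fst q = i) :: int) = 0" for i
    by (intro sum.neutral ballI) (metis (mono_tags, lifting) case_prod_conv diff_self surj_pair)
  ultimately show "crossing_index D = crossing_index D'"
    by (intro crossing_index_local_change[OF D lc]) simp
qed

lemma adds_virtual_bigon_index:
  assumes D: "virtual_link_diagram D" "virtual_link_diagram D'" and ab: "adds_bigon D D' (p1, q1) (p2, q2)"
    and v: "{p1, q1} \<in> virtual_crossings D'" "{p2, q2} \<in> virtual_crossings D'"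
  shows "comps D = comps D'" "crossing_index D = crossing_index D'"
proof -
  obtain B ss where lc: "local_change B ss D D'"
    and cr: "crossings_in D B = {}" "crossings_in D' B = {{p1, q1}, {p2, q2}}"
    using ab unfolding adds_bigon_def by blast
  show "comps D = comps D'"
    using lc by (simp add: local_change_def)
  have "crossings_inside D B = {}"
    using crossings_inside_subset(1)[OF D(1)] cr(1) by (metis all_not_in_conv surj_pair)
  moreover have "crossings_inside D' B = {}"
    using crossings_inside_subset(1,2)[OF D(2)] cr(2) v unfolding virtual_crossings_def
    by (metis DiffE all_not_in_conv insertE singletonD surj_pair)
  ultimately show "crossing_index D = crossing_index D'"
    by (intro crossing_index_local_change[OF D lc]) simp
qed

section \<open>Contributions of triangles\<close>

lemma less_3_pairs: "j < k \<and> k < (3::nat) \<longleftrightarrow> (j, k) \<in> {(0, 1), (0, 2), (1, 2)}"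
  by auto

lemma triangle_crossings:
  assumes "triangle D B ss \<tau>" "P = (\<lambda>j k. pos (ss ! j) (\<tau> j k))"
  shows "crossings_in D B = {{P 0 1, P 1 0}, {P 0 2, P 2 0}, {P 1 2, P 2 1}}"
proof -
  have "crossings_in D B = {{P j k, P k j} | j k. (j, k) \<in> {(0, 1), (0, 2), (1, 2)}}"
    using assms unfolding triangle_def less_3_pairs by simp
  then show ?thesis by auto
qed

lemma triangle_strands_distinct:
  assumes "triangle D B ss \<tau>" "P = (\<lambda>j k. pos (ss ! j) (\<tau> j k))" "strands_in_disk D B ss" "length ss = 3"
    and "j < 3" "k < 3" "l < 3" "m < 3" "j \<noteq> k" "j \<noteq> l" "k \<noteq> m"
  shows "P j l \<noteq> P k m"
proof -
  have "P a b \<in> strand_params (ss ! a)" if "a < 3" "b < 3" "a \<noteq> b" for a b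
  proof -
    have "\<tau> a b \<in> angles (ss ! a)"
      using assms(1) that unfolding triangle_def by blast
    then show ?thesis
      unfolding assms(2) by (cases "ss ! a") auto
  qed
  then have "P j l \<in> strand_params (ss ! j)" "P k m \<in> strand_params (ss ! k)"
    using assms(5-) by simp_all
  moreover have "disjoint_family_on (\<lambda>j. strand_params (ss ! j)) {..<3}"
    using assms(3,4) by (simp add: strands_in_disk_def)
  then have "strand_params (ss ! j) \<inter> strand_params (ss ! k) = {}"
    using assms(5-) unfolding disjoint_family_on_def by simp
  ultimately show ?thesis
    by (metis disjoint_iff)
qed

text \<open>The top strand passes over twice, the bottom strand under twice, and the middle strand
  once each way, which cancels. The value depends only on the components of the strands, not on
  \<open>\<tau>\<close>, so it is the same before and after the slide.\<close>

lemma sum_inside_real_triangle: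
  assumes D: "virtual_link_diagram D" and tr: "triangle D B ss \<tau>" and P: "P = (\<lambda>j k. pos (ss ! j) (\<tau> j k))"
    and ss: "strands_in_disk D B ss" "length ss = 3"
    and over: "\<And>j k. j < k \<Longrightarrow> k < 3 \<Longrightarrow> (P j k, P k j) \<in> over D"
  shows "(\<Sum>(p, q)\<in>crossings_inside D B. of_bool (fst p = i) - of_bool (fst q = i) :: int) =
    2 * of_bool (fst (ss ! 0) = i) - 2 * of_bool (fst (ss ! 2) = i)"
proof -
  note cr = triangle_crossings[OF tr P]
  have o: "(P 0 1, P 1 0) \<in> over D" "(P 0 2, P 2 0) \<in> over D" "(P 1 2, P 2 1) \<in> over D"
    using over[of 0 1] over[of 0 2] over[of 1 2] by simp_all
  have "crossings_inside D B = {(P 0 1, P 1 0), (P 0 2, P 2 0), (P 1 2, P 2 1)}" (is "_ = ?S")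
  proof (intro equalityI subsetI)
    fix x assume x: "x \<in> crossings_inside D B"
    obtain p q where pq: "x = (p, q)" by (cases x)
    note pq_in = crossings_inside_subset[OF D x[unfolded pq], unfolded cr]
    \<comment> \<open>\<open>crossings_in\<close> records unordered pairs; asymmetry of
      \<open>over\<close> rules out the reversed order.\<close>
    with o show "x \<in> ?S"
      using over_crossing(5)[OF D] pq_in(1) unfolding pq doubleton_eq_iff insert_iff empty_iff by metis
  next
    fix x assume "x \<in> ?S"
    with o show "x \<in> crossings_inside D B"
      unfolding insert_iff empty_iff by (elim disjE) (auto intro!: mem_crossings_insideI simp: cr)
  qed
  \<comment> \<open>These inequalities separate the three pairs, so that the sum over the set has
    exactly three terms.\<close>
  moreover have "P 1 0 \<noteq> P 2 0" "P 0 1 \<noteq> P 1 2" "P 0 2 \<noteq> P 1 2"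
    by (rule triangle_strands_distinct[OF tr P ss]; simp)+
  ultimately have "(\<Sum>(p, q)\<in>crossings_inside D B. of_bool (fst p = i) - of_bool (fst q = i) :: int) =
    (of_bool (fst (P 0 1) = i) - of_bool (fst (P 1 0) = i)) +
    ((of_bool (fst (P 0 2) = i) - of_bool (fst (P 2 0) = i)) +
    (of_bool (fst (P 1 2) = i) - of_bool (fst (P 2 1) = i)))"
    by simp
  then show ?thesis
    by (simp add: P)
qed

text \<open>Only the crossing of strands 1 and 2 is real. Again the value does not involve
  \<open>\<tau>\<close>, hence agrees on both sides of the slide.\<close>

lemma sum_inside_mixed_triangle:
  assumes D: "virtual_link_diagram D" and tr: "triangle D B ss \<tau>" and P: "P = (\<lambda>j k. pos (ss ! j) (\<tau> j k))"
    and v: "{P 0 1, P 1 0} \<in> virtual_crossings D" "{P 0 2, P 2 0} \<in> virtual_crossings D"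
    and over: "(P 1 2, P 2 1) \<in> over D"
  shows "(\<Sum>(p, q)\<in>crossings_inside D B. of_bool (fst p = i) - of_bool (fst q = i) :: int) =
    of_bool (fst (ss ! 1) = i) - of_bool (fst (ss ! 2) = i)"
proof -
  note cr = triangle_crossings[OF tr P]
  have "crossings_inside D B = {(P 1 2, P 2 1)}"
  proof (intro equalityI subsetI)
    fix x assume x: "x \<in> crossings_inside D B"
    obtain p q where pq: "x = (p, q)" by (cases x)
    note pq_in = crossings_inside_subset[OF D x[unfolded pq], unfolded cr]
    then have "{p, q} = {P 1 2, P 2 1}"
      using v unfolding virtual_crossings_def by (metis DiffD2 insertE singletonD)
    with pq_in(3) have "x = (P 1 2, P 2 1)"
      using over over_crossing(5)[OF D] unfolding pq doubleton_eq_iff by metis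
    then show "x \<in> {(P 1 2, P 2 1)}"
      by simp
  next
    fix x assume "x \<in> {(P 1 2, P 2 1)}"
    with over show "x \<in> crossings_inside D B"
      by (auto intro!: mem_crossings_insideI simp: cr)
  qed
  then show ?thesis
    by (simp add: P)
qed

lemma inside_virtual_triangle:
  assumes D: "virtual_link_diagram D" and tr: "triangle D B ss \<tau>" and P: "P = (\<lambda>j k. pos (ss ! j) (\<tau> j k))"
    and v: "\<And>j k. j < k \<Longrightarrow> k < 3 \<Longrightarrow> {P j k, P k j} \<in> virtual_crossings D"
  shows "crossings_inside D B = {}"
proof (rule equals0I)
  fix x assume x: "x \<in> crossings_inside D B"
  obtain p q where pq: "x = (p, q)" by (cases x)
  note pq_in = crossings_inside_subset[OF D x[unfolded pq], unfolded triangle_crossings[OF tr P]]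
  moreover have "{{P 0 1, P 1 0}, {P 0 2, P 2 0}, {P 1 2, P 2 1}} \<subseteq> virtual_crossings D"
    using v[of 0 1] v[of 0 2] v[of 1 2] by simp
  ultimately show False
    unfolding virtual_crossings_def by blast
qed

lemma directed_move_index:
  assumes D: "virtual_link_diagram D" "virtual_link_diagram D'" and m: "directed_move M D D'" "M \<noteq> RII"
  shows "comps D = comps D' \<and> crossing_index D = crossing_index D'"
proof (cases M)
  case RI
  with m show ?thesis using adds_kink_index[OF D] by auto
next
  case RII
  with m show ?thesis by simp
next
  case VRI
  with m show ?thesis using adds_kink_index[OF D] by auto
next
  case VRII
  with m obtain p1 q1 p2 q2 where "adds_bigon D D' (p1, q1) (p2, q2)"
    "{p1, q1} \<in> virtual_crossings D'" "{p2, q2} \<in> virtual_crossings D'"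
    by auto
  then show ?thesis using adds_virtual_bigon_index[OF D] by blast
next
  case RIII
  obtain P P' where sl: "slides_triangle D D' P P'"
    and over: "\<And>j k. j < k \<Longrightarrow> k < 3 \<Longrightarrow> (P j k, P k j) \<in> over D"
      "\<And>j k. j < k \<Longrightarrow> k < 3 \<Longrightarrow> (P' j k, P' k j) \<in> over D'"
    using m(1) unfolding RIII directed_move.simps by blast
  from sl obtain B ss \<tau> \<tau>' where ss: "length ss = 3" and lc: "local_change B ss D D'"
    and tr: "triangle D B ss \<tau>" "triangle D' B ss \<tau>'"
    and P: "P = (\<lambda>j k. pos (ss ! j) (\<tau> j k))" "P' = (\<lambda>j k. pos (ss ! j) (\<tau>' j k))"
    unfolding slides_triangle_def by blast
  have st: "strands_in_disk D B ss" "strands_in_disk D' B ss"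
    using lc by (simp_all add: local_change_def)
  have "crossing_index D = crossing_index D'"
    by (rule crossing_index_local_change[OF D lc],
        subst sum_inside_real_triangle[OF D(1) tr(1) P(1) st(1) ss over(1)], assumption+,
        subst sum_inside_real_triangle[OF D(2) tr(2) P(2) st(2) ss over(2)], assumption+) (rule HOL.refl)
  with lc show ?thesis
    by (simp add: local_change_def)
next
  case VRIII
  obtain P P' where sl: "slides_triangle D D' P P'"
    and v: "\<And>j k. j < k \<Longrightarrow> k < 3 \<Longrightarrow> {P j k, P k j} \<in> virtual_crossings D"
      "\<And>j k. j < k \<Longrightarrow> k < 3 \<Longrightarrow> {P' j k, P' k j} \<in> virtual_crossings D'"
    using m(1) unfolding VRIII directed_move.simps by blast
  from sl obtain B ss \<tau> \<tau>' where lc: "local_change B ss D D'"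
    and tr: "triangle D B ss \<tau>" "triangle D' B ss \<tau>'"
    and P: "P = (\<lambda>j k. pos (ss ! j) (\<tau> j k))" "P' = (\<lambda>j k. pos (ss ! j) (\<tau>' j k))"
    unfolding slides_triangle_def by blast
  have "crossing_index D = crossing_index D'"
    using inside_virtual_triangle[OF D(1) tr(1) P(1) v(1)] inside_virtual_triangle[OF D(2) tr(2) P(2) v(2)]
    by (intro crossing_index_local_change[OF D lc]) simp
  with lc show ?thesis
    by (simp add: local_change_def)
next
  case VRIV
  obtain P P' where sl: "slides_triangle D D' P P'"
    and v: "\<forall>k\<in>{1, 2}. {P 0 k, P k 0} \<in> virtual_crossings D \<and> {P' 0 k, P' k 0} \<in> virtual_crossings D'"
    and over: "(P 1 2, P 2 1) \<in> over D" "(P' 1 2, P' 2 1) \<in> over D'"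
    using m(1) unfolding VRIV directed_move.simps by blast
  from sl obtain B ss \<tau> \<tau>' where lc: "local_change B ss D D'"
    and tr: "triangle D B ss \<tau>" "triangle D' B ss \<tau>'"
    and P: "P = (\<lambda>j k. pos (ss ! j) (\<tau> j k))" "P' = (\<lambda>j k. pos (ss ! j) (\<tau>' j k))"
    unfolding slides_triangle_def by blast
  have "crossing_index D = crossing_index D'"
    using sum_inside_mixed_triangle[OF D(1) tr(1) P(1) _ _ over(1)] sum_inside_mixed_triangle[OF D(2) tr(2) P(2) _ _ over(2)] v
    by (intro crossing_index_local_change[OF D lc]) simp
  with lc show ?thesis
    by (simp add: local_change_def)
qed

section \<open>Isotopies and reparametrizations\<close>

lemma circle_reparam_inj:
  assumes "circle_reparam \<phi>"
  shows "inj_on \<phi> (sphere 0 1)"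
proof -
  obtain f :: "real \<Rightarrow> real" where mono: "strict_mono f" and per: "\<And>t. f (t + 2 * pi) = f t + 2 * pi"
    and \<phi>: "\<And>t. \<phi> (cis t) = cis (f t)"
    using assms unfolding circle_reparam_def by blast
  \<comment> \<open>Strict monotonicity together with the shift rule for \<open>2 * pi\<close> keeps
    the lifted angles strictly less than one full turn apart.\<close>
  have neq: "\<phi> (cis s) \<noteq> \<phi> (cis t)" if "s < t" "t < s + 2 * pi" for s t
  proof
    assume "\<phi> (cis s) = \<phi> (cis t)"
    then have "cis (f t - f s) = 1"
      unfolding \<phi> by (simp add: cis_divide[symmetric])
    moreover have "0 < f t - f s" "f t - f s < 2 * pi"
      using strict_monoD[OF mono that(1)] strict_monoD[OF mono that(2)] by (simp_all add: per)
    ultimately show False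
      using Arg2pi_cis[of "f t - f s"] Arg2pi_cis[of 0] by simp
  qed
  show ?thesis
  proof (rule inj_onI)
    fix z w :: complex assume zw: "z \<in> sphere 0 1" "w \<in> sphere 0 1" "\<phi> z = \<phi> w"
    then have "cis (Arg2pi z) = z" "cis (Arg2pi w) = w"
      by (simp_all add: cis_Arg2pi)
    moreover have "\<not> Arg2pi z < Arg2pi w" "\<not> Arg2pi w < Arg2pi z"
      using neq[of "Arg2pi z" "Arg2pi w"] neq[of "Arg2pi w" "Arg2pi z"] calculation zw(3)
        Arg2pi_bounds[of z] Arg2pi_bounds[of w] by auto
    ultimately show "z = w"
      by (metis linorder_neqE)
  qed
qed

text \<open>The induced map on parameters is injective and sends component \<open>i\<close> to
  \<open>\<pi> i\<close>, so it transports the crossing list without merging terms of the sum.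
  Unlike a move, an isotopy may renumber the components, hence the \<open>\<pi>\<close> in the
  conclusion.\<close>

lemma plane_isotopic_index:
  assumes D: "virtual_link_diagram D" and iso: "plane_isotopic D D'"
  obtains \<pi> where "bij_betw \<pi> {..<comps D} {..<comps D'}"
    "\<And>i. i < comps D \<Longrightarrow> crossing_index D' (\<pi> i) = crossing_index D i"
proof -
  obtain \<pi> \<phi> where \<pi>: "bij_betw \<pi> {..<comps D} {..<comps D'}"
    and \<phi>: "\<And>i. i < comps D \<Longrightarrow> circle_reparam (\<phi> i)"
    and over: "over D' = map_prod (\<lambda>(i, z). (\<pi> i, \<phi> i z)) (\<lambda>(i, z). (\<pi> i, \<phi> i z)) ` over D"
    using iso unfolding plane_isotopic_def by blast
  define f where "f = (\<lambda>(i, z). (\<pi> i, \<phi> i z))"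
  have inj_f: "inj_on f (params D)"
  proof (rule inj_onI)
    fix p q assume pq: "p \<in> params D" "q \<in> params D" "f p = f q"
    obtain i z j w where iz: "p = (i, z)" "q = (j, w)" by fastforce
    with pq have "i < comps D" "j < comps D" "\<pi> i = \<pi> j"
      by (auto simp: params_def f_def)
    then have "i = j"
      using \<pi> unfolding bij_betw_def inj_on_def by auto
    moreover have "z = w"
      using pq iz \<open>i = j\<close> inj_onD[OF circle_reparam_inj[OF \<phi>], of i z w]
      by (auto simp: params_def f_def)
    ultimately show "p = q"
      by (simp add: iz)
  qed
  have sub: "over D \<subseteq> params D \<times> params D"
    using over_crossing(1,2)[OF D] by auto
  then have inj: "inj_on (map_prod f f) (over D)"
    using map_prod_inj_on[OF inj_f inj_f] inj_on_subset by blast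
  have "crossing_index D' (\<pi> i) = crossing_index D i" if i: "i < comps D" for i
  proof -
    have fst_f: "fst (f p) = \<pi> i \<longleftrightarrow> fst p = i" if "p \<in> params D" for p
      using that i \<pi> unfolding bij_betw_def inj_on_def params_def f_def by auto
    have "crossing_index D' (\<pi> i) =
        (\<Sum>x\<in>over D. of_bool (fst (f (fst x)) = \<pi> i) - of_bool (fst (f (snd x)) = \<pi> i))"
      unfolding crossing_index_def over f_def[symmetric] sum.reindex[OF inj]
      by (simp add: case_prod_beta)
    also have "\<dots> = (\<Sum>x\<in>over D. of_bool (fst (fst x) = i) - of_bool (fst (snd x) = i))"
    proof (rule sum.cong)
      fix x assume "x \<in> over D"
      then have "fst x \<in> params D" "snd x \<in> params D"
        using sub by auto
      then show "of_bool (fst (f (fst x)) = \<pi> i) - of_bool (fst (f (snd x)) = \<pi> i) =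
          (of_bool (fst (fst x) = i) - of_bool (fst (snd x) = i) :: int)"
        by (simp add: fst_f)
    qed simp
    finally show ?thesis
      by (simp add: crossing_index_def case_prod_beta)
  qed
  with \<pi> show ?thesis
    by (rule that)
qed

section \<open>Invariance of the number of colorings\<close>

lemma card_up_down_colorings_isotopy:
  assumes "virtual_link_diagram D" "virtual_link_diagram D'" "plane_isotopic D D'" "n > 0"
  shows "card (up_down_colorings n D) = card (up_down_colorings n D')"
proof -
  obtain \<pi> where \<pi>: "bij_betw \<pi> {..<comps D} {..<comps D'}"
    and index: "\<And>i. i < comps D \<Longrightarrow> crossing_index D' (\<pi> i) = crossing_index D i"
    using plane_isotopic_index[OF assms(1,3)] by blast
  \<comment> \<open>The count sees the indices only through a condition on all of them, which is
    insensitive to renumbering.\<close>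
  have "(\<forall>i\<in>\<pi> ` {..<comps D}. int n dvd crossing_index D' i) \<longleftrightarrow>
      (\<forall>i\<in>{..<comps D}. int n dvd crossing_index D i)"
    using index by simp
  then have "(\<forall>i<comps D'. int n dvd crossing_index D' i) \<longleftrightarrow>
      (\<forall>i<comps D. int n dvd crossing_index D i)"
    unfolding bij_betw_imp_surj_on[OF \<pi>] Ball_def lessThan_iff .
  moreover have "comps D = comps D'"
    using bij_betw_same_card[OF \<pi>] by simp
  ultimately show ?thesis
    by (simp only: card_up_down_colorings[OF assms(1,4)] card_up_down_colorings[OF assms(2,4)])
qed

lemma card_up_down_colorings_move:
  assumes "virtual_link_diagram D" "virtual_link_diagram D'" "generalized_reidemeister M D D'"
    "M \<noteq> RII" "n > 0"
  shows "card (up_down_colorings n D) = card (up_down_colorings n D')"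
proof -
  \<comment> \<open>The conclusion is symmetric in the two diagrams, so a move read backward is
    covered by exchanging them.\<close>
  have "comps D = comps D' \<and> crossing_index D = crossing_index D'"
    using directed_move_index[of D D' M] directed_move_index[of D' D M] assms
    unfolding generalized_reidemeister_def by metis
  then show ?thesis
    by (simp only: card_up_down_colorings[OF assms(1,5)] card_up_down_colorings[OF assms(2,5)])
qed

text \<open>In an induction step the rules assert validity only of the diagram in front; that of the
  intermediate diagram \<open>E\<close> comes from the rest of the sequence, which starts at
  \<open>E\<close>.\<close>

lemma move_sequence_diagram: "move_sequence D Ms D' \<Longrightarrow> virtual_link_diagram D"
  by (cases rule: move_sequence.cases)

lemma card_up_down_colorings_move_sequence:
  assumes "move_sequence D Ms D'" "RII \<notin> set Ms" "n > 0"
  shows "card (up_down_colorings n D) = card (up_down_colorings n D')"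
  using assms(1,2)
proof (induction rule: move_sequence.induct)
  case (refl D)
  show ?case by (rule HOL.refl)
next
  case (isotopy D E Ms D')
  then have "card (up_down_colorings n D) = card (up_down_colorings n E)"
    using move_sequence_diagram[of E Ms D'] assms(3) by (intro card_up_down_colorings_isotopy)
  with isotopy show ?case by simp
next
  case (move D M E Ms D')
  then have "card (up_down_colorings n D) = card (up_down_colorings n E)"
    using move_sequence_diagram[of E Ms D'] assms(3)
    by (intro card_up_down_colorings_move[of D E M]) auto
  with move show ?case by simp
qed

theorem theorem1p1:
  fixes n :: nat and D D' :: diagram
  assumes "n > 0"
    and "virtual_link_diagram D" and "virtual_link_diagram D'"
    and "same_virtual_link D D'"
    and "card (up_down_colorings n D) \<noteq> card (up_down_colorings n D')"
  shows "\<forall>Ms. move_sequence D Ms D' \<longrightarrow> RII \<in> set Ms"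
  using card_up_down_colorings_move_sequence[of D _ D' n] assms(1,5) by blast

end
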